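(* Let $d=1$ and let $a:\mathbb R\to[0,\infty)$ be a bounded, continuous, even, integrable function with $\int_{\mathbb R}a(x)\,dx=1$. Suppose that for some constant $c>0$ $$\lim_{|x|\to\infty}\frac{\ln a(x)}{|x|}=-c,$$ and that for every $0\le\kappa<c$ the function $v\mapsto\tilde a(i\kappa+v)=\int_{\mathbb R}a(x)e^{\kappa x}e^{-ivx}\,dx$ belongs to $L^1(\mathbb R)$. Let $\lambda>0$ and $G_\lambda(x)=\sum_{k=1}^\infty(1+\lambda)^{-k}a_k(x)$, where $a_k=a^{*k}$ is the $k$-fold convolution of $a$ with itself. Then: 1) If there exists $q=q(\lambda)\in(0,c)$ with $\tilde a(iq)=\int_{\mathbb R}a(x)e^{qx}\,dx=1+\lambda$, then there is a constant $C(\lambda)>0$ such that $$G_\lambda(x)=e^{-q(\lambda)|x|}\,(C(\lambda)+o(1)),\qquad |x|\to\infty .$$ 2) Otherwise, for every $\varepsilon>0$ there exist positive constants $C_-(\lambda)$, $C_+(\lambda)$ (which may depend on $\varepsilon$) such that $$C_-(\lambda)e^{-(c+\varepsilon)|x|}\le G_\lambda(x)\le C_+(\lambda)e^{-(c-\varepsilon)|x|}\quad\text{for all }x\in\mathbb R .$$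
   Context: The Fourier transform is $\tilde a(p)=\int_{\mathbb R}e^{-ipx}a(x)\,dx$, which under the decay assumption is analytic in the strip $|\mathrm{Im}\,p|<c$. The convolution powers are $a_1=a$ and $a_{k+1}(x)=\int_{\mathbb R}a(x-y)a_k(y)\,dy$. The function $G_\lambda$ arises from the resolvent of $(L_0u)(x)=\int_{\mathbb R}a(x-y)(u(y)-u(x))\,dy$: the kernel of $(\lambda-L_0)^{-1}$ is $(1+\lambda)^{-1}(\delta(x-y)+G_\lambda(x-y))$. *)

theory Defs
  imports "HOL-Analysis.Analysis" "HOL-Library.Landau_Symbols"
begin

definition fourier :: "(real \<Rightarrow> real) \<Rightarrow> complex \<Rightarrow> complex" where
  "fourier a p = (\<integral>x. exp (- \<i> * p * complex_of_real x) * complex_of_real (a x) \<partial>lborel)"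

definition convolution :: "(real \<Rightarrow> real) \<Rightarrow> (real \<Rightarrow> real) \<Rightarrow> real \<Rightarrow> real" where
  "convolution f g x = (\<integral>y. f (x - y) * g y \<partial>lborel)"

text \<open>Convolution powers are indexed from 1; the value at index 0 (mathematically a Dirac
  delta) is a placeholder that is never used.\<close>

fun conv_power :: "(real \<Rightarrow> real) \<Rightarrow> nat \<Rightarrow> real \<Rightarrow> real" where
  "conv_power a 0 = (\<lambda>_. 0)"
| "conv_power a (Suc 0) = a"
| "conv_power a (Suc (Suc k)) = convolution a (conv_power a (Suc k))"

text \<open>The summation index is shifted by one: the term for \<open>k\<close> is
  $(1+\lambda)^{-(k+1)} a_{k+1}(x)$.\<close>

definition resolvent_kernel :: "(real \<Rightarrow> real) \<Rightarrow> real \<Rightarrow> real \<Rightarrow> real" where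
  "resolvent_kernel a l x = (\<Sum>k. conv_power a (Suc k) x / (1 + l) ^ Suc k)"

end

theory Submission
  imports Defs "HOL-Probability.Characteristic_Functions" "HOL-Probability.Sinc_Integral"
begin

text \<open>Tilting: \<open>f x = exp (\<kappa> x) a x / (1 + \<lambda>)\<close> has convolution powers
  \<open>exp (\<kappa> x) a\<^sub>k x / (1 + \<lambda>)\<^sup>k\<close>, so \<open>exp (\<kappa> x) G\<^sub>\<lambda> x\<close> is the sum of the convolution powers of \<open>f\<close>.

  If \<open>\<kappa> = q\<close>, then \<open>f\<close> is a probability density with positive mean \<open>\<mu>\<close>, and \<open>exp (q x) G\<^sub>\<lambda> x\<close> is its renewal
  density, which tends to \<open>1 / \<mu>\<close>. Instead of shifting a contour past the pole at \<open>\<i> q\<close>, one subtracts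
  it on the real line: with \<open>\<phi>\<close> the Fourier transform of \<open>f\<close> and \<open>F\<close> its distribution function,
  the renewal density minus \<open>F / \<mu>\<close> is the inverse transform of
  \<open>\<phi> v (1 / (1 - \<phi> v) - 1 / (\<i> \<mu> v))\<close>. The bracket is bounded, so this is integrable and the difference
  vanishes at infinity by the Riemann--Lebesgue lemma. The identity is reached by Abel summation
  \<open>r \<rightarrow> 1\<close>, replacing \<open>\<phi>\<close> by \<open>r \<phi>\<close> and \<open>\<i> \<mu> v\<close> by \<open>(1 - r) + \<i> \<mu> v\<close>.

  If no such \<open>q\<close> exists, \<open>f\<close> has mass less than 1 for every \<open>\<kappa> < c\<close> by the intermediate value
  theorem, and the series is dominated by a geometric one.\<close>

section \<open>Fourier transforms and the Riemann--Lebesgue lemma\<close>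

lemma borel_measurable_cis [measurable (raw)]:
  "g \<in> borel_measurable N \<Longrightarrow> (\<lambda>x. cis (g x)) \<in> borel_measurable N"
proof -
  have "cis \<in> borel_measurable borel"
    by (intro borel_measurable_continuous_onI continuous_intros)
  then show "g \<in> borel_measurable N \<Longrightarrow> (\<lambda>x. cis (g x)) \<in> borel_measurable N"
    by (rule measurable_compose_rev)
qed

lemma integrable_cis_mult:
  fixes g :: "'a \<Rightarrow> complex"
  assumes "integrable N g" and [measurable]: "h \<in> borel_measurable N"
  shows "integrable N (\<lambda>x. cis (h x) * g x)"
proof -
  have [measurable]: "g \<in> borel_measurable N" using assms by simp
  show ?thesis
    by (rule Bochner_Integration.integrable_bound[OF assms(1)]) (auto simp: norm_mult)
qed

lemma fourier_of_real:
  "fourier f (complex_of_real v) = (\<integral>x. cis (- (v * x)) * complex_of_real (f x) \<partial>lborel)"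
  unfolding fourier_def by (intro Bochner_Integration.integral_cong) (auto simp: cis_conv_exp mult_ac)

lemma integrable_reflect_shift_iff:
  fixes g :: "real \<Rightarrow> 'a::{banach, second_countable_topology}"
  shows "integrable lborel (\<lambda>y. g (x - y)) \<longleftrightarrow> integrable lborel g"
  using lborel_integrable_real_affine_iff[of "-1" g x] by simp

lemma integral_reflect_shift:
  fixes g :: "real \<Rightarrow> 'a::{banach, second_countable_topology}"
  shows "(\<integral>y. g (x - y) \<partial>lborel) = integral\<^sup>L lborel g"
  using lborel_integral_real_affine[of "-1" g x] by simp

lemma integral_shift:
  fixes g :: "real \<Rightarrow> 'a::{banach, second_countable_topology}"
  shows "(\<integral>y. g (x + y) \<partial>lborel) = integral\<^sup>L lborel g"
  using lborel_integral_real_affine[of "1" g x] by simp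

text \<open>Translating by \<open>\<pi> / t\<close> flips the sign of the oscillating factor, so twice the integral is
  bounded by the \<open>L\<^sup>1\<close>-modulus of continuity, which vanishes at 0 by Scheffe's lemma.\<close>

lemma Riemann_Lebesgue:
  fixes g :: "real \<Rightarrow> complex"
  assumes g: "integrable lborel g" and cont: "AE x in lborel. isCont g x"
  shows "((\<lambda>t. \<integral>x. cis (t * x) * g x \<partial>lborel) \<longlongrightarrow> 0) at_infinity"
proof -
  have [measurable]: "g \<in> borel_measurable lborel" using g by simp
  have shift: "integrable lborel (\<lambda>x. g (h + x))" for h
    using lborel_integrable_real_affine[OF g, of 1 h] by simp
  define T where "T h = (\<integral>x. norm (g (h + x) - g x) \<partial>lborel)" for h
  have T0: "(T \<longlongrightarrow> 0) (at 0)"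
    unfolding tendsto_at_iff_sequentially comp_def
  proof (intro allI impI)
    fix X :: "nat \<Rightarrow> real"
    assume "\<forall>i. X i \<in> UNIV - {0}" and X: "X \<longlonglongrightarrow> 0"
    have "(\<lambda>n. \<integral>\<^sup>+ x. norm (g (X n + x) - g x) \<partial>lborel) \<longlonglongrightarrow> 0"
    proof (rule Scheffe_lemma2)
      show "AE x in lborel. (\<lambda>n. g (X n + x)) \<longlonglongrightarrow> g x"
        using cont
      proof eventually_elim
        fix x assume "isCont g x"
        moreover have "(\<lambda>n. X n + x) \<longlonglongrightarrow> x"
          using tendsto_add[OF X tendsto_const[of x]] by simp
        ultimately show "(\<lambda>n. g (X n + x)) \<longlonglongrightarrow> g x"
          using isCont_tendsto_compose by blast
      qed
      show "(\<integral>\<^sup>+ x. norm (g (X n + x)) \<partial>lborel) \<le> (\<integral>\<^sup>+ x. norm (g x) \<partial>lborel)" for n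
        using nn_integral_real_affine[of "\<lambda>x. ennreal (norm (g x))" 1 "X n"] by simp
    qed (use g in auto)
    moreover have "(\<integral>\<^sup>+ x. norm (g (X n + x) - g x) \<partial>lborel) = ennreal (T (X n))" for n
      unfolding T_def by (intro nn_integral_eq_integral Bochner_Integration.integrable_norm
        Bochner_Integration.integrable_diff shift g) auto
    ultimately have "(\<lambda>n. ennreal (T (X n))) \<longlonglongrightarrow> ennreal 0" by simp
    then show "(\<lambda>n. T (X n)) \<longlonglongrightarrow> 0"
      by (subst (asm) tendsto_ennreal_iff) (auto simp: T_def intro!: always_eventually)
  qed
  have flim: "filterlim (\<lambda>t::real. pi / t) (at 0) at_infinity"
    unfolding filterlim_at
    by (auto intro!: tendsto_divide_0[OF tendsto_const] filterlim_ident
      simp: eventually_at_infinity intro: exI[of _ 1])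
  have bound: "norm (\<integral>x. cis (t * x) * g x \<partial>lborel) \<le> T (pi / t)" if "t \<noteq> 0" for t
  proof -
    let ?J = "\<integral>x. cis (t * x) * g x \<partial>lborel"
    have "?J = (\<integral>x. cis (t * (pi / t + x)) * g (pi / t + x) \<partial>lborel)"
      using integral_shift[of "\<lambda>x. cis (t * x) * g x" "pi / t"] by simp
    also have "\<dots> = (\<integral>x. - (cis (t * x) * g (pi / t + x)) \<partial>lborel)"
      using that by (intro Bochner_Integration.integral_cong)
        (auto simp: distrib_left cis_mult[symmetric])
    finally have "?J = - (\<integral>x. cis (t * x) * g (pi / t + x) \<partial>lborel)" by simp
    then have "2 * ?J = ?J - (\<integral>x. cis (t * x) * g (pi / t + x) \<partial>lborel)" by simp
    also have "\<dots> = (\<integral>x. cis (t * x) * g x - cis (t * x) * g (pi / t + x) \<partial>lborel)"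
      by (intro Bochner_Integration.integral_diff[symmetric] integrable_cis_mult g shift) auto
    finally have "norm (2 * ?J) \<le> (\<integral>x. norm (cis (t * x) * g x - cis (t * x) * g (pi / t + x)) \<partial>lborel)"
      by simp
    also have "\<dots> = T (pi / t)"
      unfolding T_def
      by (intro Bochner_Integration.integral_cong)
         (auto simp: right_diff_distrib[symmetric] norm_mult norm_minus_commute)
    finally have "2 * norm ?J \<le> T (pi / t)" by (simp add: norm_mult)
    then show ?thesis using norm_ge_zero[of ?J] by linarith
  qed
  show ?thesis
  proof (rule Lim_null_comparison)
    show "((\<lambda>t. T (pi / t)) \<longlongrightarrow> 0) at_infinity"
      by (rule filterlim_compose[OF T0 flim])
    show "\<forall>\<^sub>F t in at_infinity. norm (\<integral>x. cis (t * x) * g x \<partial>lborel) \<le> T (pi / t)"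
      unfolding eventually_at_infinity by (rule exI[of _ 1]) (auto intro!: bound)
  qed
qed

text \<open>This is the characteristic function of the standard normal law, rewritten as a Lebesgue
  integral. It supplies the Gaussian cut-off for the inversion formula.\<close>

lemma std_normal_transform:
  "(\<integral>z. cis (t * z) * complex_of_real (std_normal_density z) \<partial>lborel) = exp (- (t^2) / 2)"
proof -
  have "char std_normal_distribution t = (\<integral>z. std_normal_density z *\<^sub>R iexp (t * z) \<partial>lborel)"
    unfolding char_def
    by (subst integral_density) (auto simp: normal_density_nonneg)
  then show ?thesis
    unfolding char_std_normal_distribution
    by (simp add: cis_conv_exp scaleR_conv_of_real mult_ac)
qed

lemma continuous_fourier:
  assumes f: "integrable lborel f"
  shows "isCont (\<lambda>v. fourier f (complex_of_real v)) v"
  unfolding continuous_at_sequentially comp_def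
proof (intro allI impI)
  fix X :: "nat \<Rightarrow> real" assume X: "X \<longlonglongrightarrow> v"
  have [measurable]: "f \<in> borel_measurable lborel" using f by simp
  show "(\<lambda>n. fourier f (complex_of_real (X n))) \<longlonglongrightarrow> fourier f (complex_of_real v)"
    unfolding fourier_of_real
  proof (rule integral_dominated_convergence[where w="\<lambda>x. norm (f x)"])
    show "AE x in lborel. (\<lambda>i. cis (- (X i * x)) * complex_of_real (f x))
        \<longlonglongrightarrow> cis (- (v * x)) * complex_of_real (f x)"
      by (intro AE_I2 tendsto_intros X isCont_tendsto_compose[of _ cis] continuous_intros) 
  qed (use f in \<open>auto simp: norm_mult\<close>)
qed

lemma norm_fourier_le:
  assumes "\<And>x. 0 \<le> f x"
  shows "norm (fourier f (complex_of_real v)) \<le> integral\<^sup>L lborel f"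
proof -
  have "norm (fourier f (complex_of_real v)) \<le> (\<integral>x. norm (cis (- (v * x)) * complex_of_real (f x)) \<partial>lborel)"
    unfolding fourier_of_real by (rule integral_norm_bound)
  also have "\<dots> = integral\<^sup>L lborel f"
    using assms by (simp add: norm_mult)
  finally show ?thesis .
qed

text \<open>The modulus is \<open>\<bar>f (x - y)\<bar> * norm (\<psi> v)\<close>, a product of
  integrable functions of the separate variables. This licenses the exchange of integrals in the
  convolution theorem.\<close>

lemma integrable_cis_convolution:
  fixes f :: "real \<Rightarrow> real" and \<psi> :: "real \<Rightarrow> complex"
  assumes f: "integrable lborel f" and \<psi>: "integrable lborel \<psi>"
  shows "integrable (lborel \<Otimes>\<^sub>M lborel)
    (\<lambda>(y, v). complex_of_real (f (x - y)) * (cis (v * y) * \<psi> v))"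
proof -
  have [measurable]: "f \<in> borel_measurable lborel" "\<psi> \<in> borel_measurable lborel"
    using f \<psi> by simp_all
  have "integrable lborel (\<lambda>v. cis (v * y) * \<psi> v)" for y
    by (intro integrable_cis_mult \<psi>) auto
  moreover have "integrable lborel (\<lambda>y. norm (f (x - y)) * (\<integral>v. norm (\<psi> v) \<partial>lborel))"
    using f integrable_reflect_shift_iff[of f x] by auto
  ultimately show ?thesis
    by (intro lborel_pair.Fubini_integrable) (auto simp: norm_mult)
qed

text \<open>The convolution theorem on the inverse side: exchange the integrals, then substitute
  \<open>x - y\<close> for \<open>y\<close>. The function \<open>g\<close> enters only through an
  absolutely convergent inverse transform. It is used for Gaussian averages, for convolution powers
  by induction, and for smoothed distribution functions.\<close>

lemma convolution_inverse_transform: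
  fixes f g :: "real \<Rightarrow> real" and \<psi> :: "real \<Rightarrow> complex"
  assumes f: "integrable lborel f" and \<psi>: "integrable lborel \<psi>"
    and g: "\<And>y. complex_of_real (g y) = (\<integral>v. cis (v * y) * \<psi> v \<partial>lborel)"
  shows "complex_of_real (Defs.convolution f g x) =
    (\<integral>v. cis (v * x) * (fourier f (complex_of_real v) * \<psi> v) \<partial>lborel)"
proof -
  have "complex_of_real (Defs.convolution f g x) = (\<integral>y. complex_of_real (f (x - y)) * complex_of_real (g y) \<partial>lborel)"
    unfolding Defs.convolution_def by (simp flip: of_real_mult)
  also have "\<dots> = (\<integral>y. (\<integral>v. complex_of_real (f (x - y)) * (cis (v * y) * \<psi> v) \<partial>lborel) \<partial>lborel)"
    unfolding g by simp
  also have "\<dots> = (\<integral>v. (\<integral>y. complex_of_real (f (x - y)) * (cis (v * y) * \<psi> v) \<partial>lborel) \<partial>lborel)"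
    using lborel_pair.Fubini_integral[OF integrable_cis_convolution[OF f \<psi>, of x]] by simp
  also have "\<dots> = (\<integral>v. cis (v * x) * (fourier f (complex_of_real v) * \<psi> v) \<partial>lborel)"
  proof (rule Bochner_Integration.integral_cong)
    fix v
    have "(\<integral>y. complex_of_real (f (x - y)) * (cis (v * y) * \<psi> v) \<partial>lborel) =
      (\<integral>y. complex_of_real (f y) * (cis (v * (x - y)) * \<psi> v) \<partial>lborel)"
      using integral_reflect_shift[of "\<lambda>y. complex_of_real (f y) * (cis (v * (x - y)) * \<psi> v)" x]
      by simp
    also have "\<dots> = (\<integral>y. (cis (v * x) * \<psi> v) * (cis (- (v * y)) * complex_of_real (f y)) \<partial>lborel)"
      by (intro Bochner_Integration.integral_cong)
         (auto simp: right_diff_distrib cis_divide[symmetric] field_simps cis_inverse[symmetric])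
    also have "\<dots> = (cis (v * x) * \<psi> v) * fourier f (complex_of_real v)"
      unfolding fourier_of_real by (rule integral_mult_right_zero)
    finally show "(\<integral>y. complex_of_real (f (x - y)) * (cis (v * y) * \<psi> v) \<partial>lborel) =
      cis (v * x) * (fourier f (complex_of_real v) * \<psi> v)" by (simp add: mult_ac)
  qed simp
  finally show ?thesis .
qed

section \<open>Fourier inversion and convolution powers\<close>

text \<open>The transform is cut off by a Gaussian of width \<open>1 / s\<close>; this replaces \<open>f\<close> by its average
  against a Gaussian of width \<open>s\<close>, and \<open>s \<rightarrow> 0\<close>.\<close>

theorem fourier_inversion:
  assumes f: "integrable lborel f" and cont: "continuous_on UNIV f" and bound: "\<And>x. \<bar>f x\<bar> \<le> M"
    and L1: "integrable lborel (\<lambda>v. fourier f (complex_of_real v))"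
  shows "complex_of_real (f x) =
    (\<integral>v. cis (v * x) * (fourier f (complex_of_real v) / (2 * pi)) \<partial>lborel)"
proof -
  let ?\<phi> = "\<lambda>v. fourier f (complex_of_real v)"
  have [measurable]: "f \<in> borel_measurable borel" "?\<phi> \<in> borel_measurable borel"
    using f L1 by auto
  \<comment> \<open>The cut-off keeps the density's factor \<open>1 / sqrt (2 * pi)\<close>, so at
    \<open>s = 0\<close> it is this constant rather than 1. A second such factor comes from the
    averaged side in \<open>smooth\<close>, and together they give \<open>2 * pi\<close>.\<close>
  define \<gamma> where "\<gamma> s v = complex_of_real (std_normal_density (s * v))" for s v
  have \<gamma>_int: "integrable lborel (\<gamma> s)" if "s > 0" for s
    unfolding \<gamma>_def using that lborel_integrable_real_affine[of "\<lambda>v. complex_of_real (std_normal_density v)" s 0]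
    by simp
  \<comment> \<open>By the convolution theorem the cut-off integral is \<open>f\<close> convolved
    with a Gaussian of width \<open>s\<close>; substituting \<open>s * z\<close> for
    \<open>y\<close> moves the dependence on \<open>s\<close> into the argument of
    \<open>f\<close>.\<close>
  have smooth: "(\<integral>v. cis (v * x) * (?\<phi> v * \<gamma> s v) \<partial>lborel)
      = complex_of_real (sqrt (2 * pi) * (\<integral>z. f (x - s * z) * std_normal_density z \<partial>lborel))" if s: "s > 0" for s
  proof -
    have G: "(\<integral>v. cis (v * y) * \<gamma> s v \<partial>lborel) = complex_of_real (exp (- (y / s)\<^sup>2 / 2) / s)" for y
    proof -
      have "(\<integral>v. cis (v * y) * \<gamma> s v \<partial>lborel) =
          (1 / s) *\<^sub>R (\<integral>z. cis (y / s * z) * complex_of_real (std_normal_density z) \<partial>lborel)"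
        unfolding \<gamma>_def using s
        by (subst lborel_integral_real_affine[of s "\<lambda>z. cis (y / s * z) * complex_of_real (std_normal_density z)" 0])
           (auto simp: mult_ac)
      then show ?thesis unfolding std_normal_transform by (simp add: scaleR_conv_of_real)
    qed
    have "(\<integral>v. cis (v * x) * (?\<phi> v * \<gamma> s v) \<partial>lborel) =
        complex_of_real (Defs.convolution f (\<lambda>y. exp (- (y / s)\<^sup>2 / 2) / s) x)"
      by (intro convolution_inverse_transform[symmetric] f \<gamma>_int s G[symmetric])
    also have "Defs.convolution f (\<lambda>y. exp (- (y / s)\<^sup>2 / 2) / s) x =
        s * (\<integral>z. f (x - s * z) * (exp (- (s * z / s)\<^sup>2 / 2) / s) \<partial>lborel)"
      unfolding Defs.convolution_def
      using s lborel_integral_real_affine[of s "\<lambda>y. f (x - y) * (exp (- (y / s)\<^sup>2 / 2) / s)" 0] by simp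
    also have "\<dots> = (\<integral>z. sqrt (2 * pi) * (f (x - s * z) * std_normal_density z) \<partial>lborel)"
      using s by (subst integral_mult_right_zero[symmetric], intro Bochner_Integration.integral_cong)
        (auto simp: std_normal_density_def)
    finally show ?thesis by simp
  qed
  let ?s = "\<lambda>n. 1 / real (Suc n)"
  have s0: "?s \<longlonglongrightarrow> 0"
    using LIMSEQ_inverse_real_of_nat by (simp add: inverse_eq_divide)
  \<comment> \<open>Both sides of \<open>smooth\<close> are taken to the limit along
    \<open>s = 1 / (n + 1)\<close>: the left is dominated by the modulus of the transform, the right
    by \<open>M\<close> times the normal density. Uniqueness of limits then gives the inversion
    formula.\<close>
  have lim1: "(\<lambda>n. \<integral>v. cis (v * x) * (?\<phi> v * \<gamma> (?s n) v) \<partial>lborel)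
      \<longlonglongrightarrow> (\<integral>v. cis (v * x) * (?\<phi> v * \<gamma> 0 v) \<partial>lborel)"
  proof (rule integral_dominated_convergence[where w="\<lambda>v. norm (?\<phi> v)"])
    show "AE v in lborel. (\<lambda>n. cis (v * x) * (?\<phi> v * \<gamma> (?s n) v)) \<longlonglongrightarrow> cis (v * x) * (?\<phi> v * \<gamma> 0 v)"
    proof (intro AE_I2 tendsto_mult_left)
      fix v :: real
      have "(\<lambda>n. ?s n * v) \<longlonglongrightarrow> 0 * v" by (rule tendsto_mult_right[OF s0])
      moreover have "isCont (\<lambda>t. complex_of_real (std_normal_density t)) (0 * v)"
        unfolding std_normal_density_def by (intro continuous_intros) auto
      ultimately show "(\<lambda>n. \<gamma> (?s n) v) \<longlonglongrightarrow> \<gamma> 0 v"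
        unfolding \<gamma>_def by (intro isCont_tendsto_compose[where g="\<lambda>t. complex_of_real (std_normal_density t)"])
    qed
    have "norm (\<gamma> s v) \<le> 1" for s v
    proof -
      have "1 \<le> sqrt (2 * pi)" using pi_gt3 by (intro real_le_rsqrt) auto
      then have "std_normal_density (s * v) \<le> 1 * 1"
        unfolding std_normal_density_def by (intro mult_mono) auto
      then show ?thesis unfolding \<gamma>_def by (simp add: normal_density_nonneg)
    qed
    then show "AE v in lborel. norm (cis (v * x) * (?\<phi> v * \<gamma> (?s n) v)) \<le> norm (?\<phi> v)" for n
      by (auto simp: norm_mult mult_left_le)
  qed (use L1 in \<open>auto simp: \<gamma>_def\<close>)
  have "(\<lambda>n. \<integral>z. f (x - ?s n * z) * std_normal_density z \<partial>lborel)
      \<longlonglongrightarrow> (\<integral>z. f x * std_normal_density z \<partial>lborel)"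
  proof (rule integral_dominated_convergence[where w="\<lambda>z. M * std_normal_density z"])
    show "AE z in lborel. (\<lambda>n. f (x - ?s n * z) * std_normal_density z) \<longlonglongrightarrow> f x * std_normal_density z"
    proof (intro AE_I2 tendsto_mult_right)
      fix z :: real
      have "(\<lambda>n. x - ?s n * z) \<longlonglongrightarrow> x - 0 * z" by (intro tendsto_intros s0)
      moreover have "isCont f (x - 0 * z)" using cont by (simp add: continuous_on_eq_continuous_at)
      ultimately show "(\<lambda>n. f (x - ?s n * z)) \<longlonglongrightarrow> f x"
        using isCont_tendsto_compose[of "x - 0 * z" f] by fastforce
    qed
    show "AE z in lborel. norm (f (x - ?s n * z) * std_normal_density z) \<le> M * std_normal_density z" for n
      by (auto simp: abs_mult normal_density_nonneg intro!: mult_right_mono bound)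
  qed auto
  then have lim2: "(\<lambda>n. complex_of_real (sqrt (2 * pi) * (\<integral>z. f (x - ?s n * z) * std_normal_density z \<partial>lborel)))
      \<longlonglongrightarrow> complex_of_real (sqrt (2 * pi) * (\<integral>z. f x * std_normal_density z \<partial>lborel))"
    by (intro tendsto_intros)
  moreover have "(\<integral>z. f x * std_normal_density z \<partial>lborel) = f x"
    by (simp add: integral_normal_density)
  moreover have "0 < ?s n" for n by simp
  ultimately have "(\<integral>v. cis (v * x) * (?\<phi> v * \<gamma> 0 v) \<partial>lborel) = complex_of_real (sqrt (2 * pi) * f x)"
    using LIMSEQ_unique[OF lim1[unfolded smooth[OF \<open>0 < ?s _\<close>]] lim2] by simp
  moreover have "\<gamma> 0 v = 1 / complex_of_real (sqrt (2 * pi))" for v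
    by (simp add: \<gamma>_def std_normal_density_def)
  ultimately have "(\<integral>v. (cis (v * x) * ?\<phi> v) / complex_of_real (sqrt (2 * pi)) \<partial>lborel) = complex_of_real (sqrt (2 * pi) * f x)"
    by simp
  then have "(\<integral>v. cis (v * x) * ?\<phi> v \<partial>lborel) = (complex_of_real (sqrt (2 * pi)) * complex_of_real (sqrt (2 * pi))) * f x"
    unfolding integral_divide_zero by (simp add: field_simps)
  also have "complex_of_real (sqrt (2 * pi)) * complex_of_real (sqrt (2 * pi)) = complex_of_real (2 * pi)"
    unfolding of_real_mult[symmetric] by simp
  finally show ?thesis by simp
qed

section \<open>Convolution powers: measurability, positivity, geometric bounds and tilting\<close>

lemma conv_power_measurable:
  assumes [measurable]: "f \<in> borel_measurable borel"
  shows "conv_power f (Suc k) \<in> borel_measurable borel"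
proof (induction k)
  case (Suc k)
  note Suc[measurable]
  have "(\<lambda>(x, y). f (x - y) * conv_power f (Suc k) y) \<in> borel_measurable (borel \<Otimes>\<^sub>M lborel)"
    by measurable
  then show ?case
    by (simp add: Defs.convolution_def[abs_def] lborel.borel_measurable_lebesgue_integral)
qed simp

lemma conv_power_nonneg:
  assumes "\<And>x. 0 \<le> f x"
  shows "0 \<le> conv_power f (Suc k) x"
  using assms by (induction k arbitrary: x) (auto simp: Defs.convolution_def)

lemma integrable_convolution:
  fixes f g :: "real \<Rightarrow> real"
  assumes "integrable lborel f" and [measurable]: "g \<in> borel_measurable borel"
    and "\<And>y. \<bar>g y\<bar> \<le> B"
  shows "integrable lborel (\<lambda>y. f (x - y) * g y)"
proof (rule Bochner_Integration.integrable_bound)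
  have [measurable]: "f \<in> borel_measurable borel" using assms(1) by simp
  show "integrable lborel (\<lambda>y. f (x - y) * B)"
    using assms(1) by (simp add: integrable_reflect_shift_iff)
  show "AE y in lborel. norm (f (x - y) * g y) \<le> norm (f (x - y) * B)"
    using order.trans[OF assms(3) abs_ge_self] by (auto simp: abs_mult intro!: mult_left_mono)
  show "(\<lambda>y. f (x - y) * g y) \<in> borel_measurable lborel" by measurable
qed

text \<open>Convolving with a nonnegative \<open>f\<close> multiplies a uniform bound by the mass of
  \<open>f\<close>. Mass below 1 thus yields geometric decay in \<open>k\<close>, and mass 1 a
  uniform bound.\<close>

lemma conv_power_le:
  assumes f: "integrable lborel f" and nonneg: "\<And>x. 0 \<le> f x" and bound: "\<And>x. f x \<le> M"
  shows "conv_power f (Suc k) x \<le> M * (integral\<^sup>L lborel f) ^ k"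
proof (induction k arbitrary: x)
  case (Suc k)
  let ?B = "M * (integral\<^sup>L lborel f) ^ k"
  have [measurable]: "f \<in> borel_measurable borel" using f by simp
  have "Defs.convolution f (conv_power f (Suc k)) x \<le> (\<integral>y. f (x - y) * ?B \<partial>lborel)"
    unfolding Defs.convolution_def
  proof (rule integral_mono)
    show "integrable lborel (\<lambda>y. f (x - y) * conv_power f (Suc k) y)"
      using Suc conv_power_nonneg[OF nonneg]
      by (intro integrable_convolution[OF f, where B="?B"] conv_power_measurable) auto
    show "integrable lborel (\<lambda>y. f (x - y) * ?B)"
      using f by (simp add: integrable_reflect_shift_iff)
  qed (use Suc nonneg in \<open>auto intro: mult_left_mono\<close>)
  also have "\<dots> = (integral\<^sup>L lborel f) * ?B" by (simp add: integral_reflect_shift)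
  finally show ?case by (simp add: mult_ac)
qed (use bound in simp)

text \<open>The exponential weight is multiplicative, \<open>exp (\<kappa> * (x - y)) * exp
  (\<kappa> * y) = exp (\<kappa> * x)\<close>, so it leaves every convolution integral unchanged
  apart from an outer factor; each factor \<open>f\<close> contributes one \<open>s\<close>.\<close>

lemma conv_power_tilt:
  "conv_power (\<lambda>x. s * (exp (\<kappa> * x) * f x)) (Suc k) x = s ^ Suc k * (exp (\<kappa> * x) * conv_power f (Suc k) x)"
proof (induction k arbitrary: x)
  case (Suc k)
  have eq: "exp (\<kappa> * (x - y)) * (exp (\<kappa> * y) * z) = exp (\<kappa> * x) * z" for y z
    by (simp add: mult.assoc[symmetric] exp_add[symmetric] algebra_simps)
  have "s * (exp (\<kappa> * (x - y)) * f (x - y)) * (s ^ Suc k * (exp (\<kappa> * y) * conv_power f (Suc k) y))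
      = (s ^ Suc (Suc k) * exp (\<kappa> * x)) * (f (x - y) * conv_power f (Suc k) y)" for y
    using eq[of y "s ^ Suc (Suc k) * (f (x - y) * conv_power f (Suc k) y)"] by (simp add: mult_ac)
  then show ?case
    unfolding conv_power.simps Defs.convolution_def Suc by (simp only: integral_mult_right_zero mult.assoc)
qed simp

lemma conv_power_even:
  assumes "\<And>x. f (- x) = f x"
  shows "conv_power f (Suc k) (- x) = conv_power f (Suc k) x"
proof (induction k arbitrary: x)
  case (Suc k)
  have "Defs.convolution f (conv_power f (Suc k)) (- x) = (\<integral>y. f (- x + y) * conv_power f (Suc k) (- y) \<partial>lborel)"
    unfolding Defs.convolution_def
    using integral_reflect_shift[of "\<lambda>y. f (- x - y) * conv_power f (Suc k) y" 0] by simp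
  also have "\<dots> = Defs.convolution f (conv_power f (Suc k)) x"
    unfolding Defs.convolution_def Suc using assms[of "x - y" for y] by simp
  finally show ?case by simp
qed (use assms in simp)

section \<open>The transform of a probability density near and away from 0\<close>

lemma integrable_exp_halfline:
  assumes "s > 0"
  shows "integrable lborel (\<lambda>x. indicator {0<..} x * exp (- s * x) :: real)"
  using integrable_I0i_exp_mscale[OF assms] by (simp add: set_integrable_def mult.commute)

text \<open>The damped step function has a transform with a simple pole at
  \<open>v = \<i> * s\<close>. Its convolution with a density gives the term that removes the
  singularity of the renewal series, with the pole kept off the real line while
  \<open>s > 0\<close>.\<close>

lemma fourier_exp_halfline:
  assumes s: "s > 0"
  shows "fourier (\<lambda>x. indicator {0<..} x * exp (- s * x)) (complex_of_real v) = 1 / (s + \<i> * v)"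
proof -
  define z where "z = complex_of_real s + \<i> * complex_of_real v"
  have z: "z \<noteq> 0" using s by (auto simp: z_def complex_eq_iff)
  let ?F = "\<lambda>x::real. - exp (- (z * x)) / z"
  have "(\<integral>x. cis (- (v * x)) * complex_of_real (indicator {0<..} x * exp (- s * x)) \<partial>lborel)
      = (LBINT x=0..\<infinity>. exp (- (z * complex_of_real x)))"
    unfolding interval_lebesgue_integral_0_infty set_lebesgue_integral_def
    by (intro Bochner_Integration.integral_cong)
       (auto simp: indicator_def cis_conv_exp exp_of_real[symmetric] exp_add[symmetric] algebra_simps z_def)
  also have "\<dots> = 0 - (- 1 / z)"
  proof (rule interval_integral_FTC_integrable[where F="?F"])
    show "(?F has_vector_derivative exp (- (z * complex_of_real x))) (at x)" for x
      using z by (auto intro!: derivative_eq_intros has_vector_derivative_real_field simp: field_simps)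
    have "integrable lborel (\<lambda>x. cis (- (v * x)) * complex_of_real (indicator {0<..} x * exp (- s * x)))"
      by (intro integrable_cis_mult integrable_of_real integrable_exp_halfline s) auto
    moreover have "einterval 0 \<infinity> = {0<..}" by (auto simp: einterval_iff)
    ultimately show "set_integrable lborel (einterval 0 \<infinity>) (\<lambda>x. exp (- (z * complex_of_real x)))"
      unfolding set_integrable_def
      by (elim back_subst[where P="integrable lborel"])
       (auto simp: fun_eq_iff indicator_def cis_conv_exp exp_of_real[symmetric] exp_add[symmetric] algebra_simps z_def)
    have "((\<lambda>x. ?F x) \<longlongrightarrow> ?F 0) (at_right 0)"
      by (intro tendsto_intros z)
    then show "((?F \<circ> real_of_ereal) \<longlongrightarrow> - 1 / z) (at_right 0)"
      unfolding zero_ereal_def by (simp add: ereal_tendsto_simps)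
    have "((\<lambda>x. exp (- s * x) / norm z) \<longlongrightarrow> 0) at_top"
      using s by (intro tendsto_divide_zero filterlim_compose[OF exp_at_bot]
        filterlim_tendsto_neg_mult_at_bot[OF tendsto_const] filterlim_ident) auto
    then have "(?F \<longlongrightarrow> 0) at_top"
      by (rule Lim_null_comparison[rotated]) (auto simp: norm_divide z_def)
    then show "((?F \<circ> real_of_ereal) \<longlongrightarrow> 0) (at_left \<infinity>)"
      by (simp add: ereal_tendsto_simps)
  qed auto
  finally show ?thesis unfolding fourier_of_real z_def by simp
qed

lemma norm_cis_taylor: "norm (cis t - (1 + \<i> * t)) \<le> t\<^sup>2 / 2"
  using iexp_approx1[of t 1] by (simp add: cis_conv_exp power2_eq_square)

text \<open>Integrate the second-order estimate for \<open>cis\<close> against \<open>f\<close>: the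
  linear term produces the mean and the error is controlled by the second moment.\<close>

lemma fourier_taylor:
  assumes f: "integrable lborel f" and nonneg: "\<And>x. 0 \<le> f x" and one: "integral\<^sup>L lborel f = 1"
    and f1: "integrable lborel (\<lambda>x. x * f x)" and f2: "integrable lborel (\<lambda>x. x\<^sup>2 * f x)"
  shows "norm (fourier f (complex_of_real v) - (1 - \<i> * v * (\<integral>x. x * f x \<partial>lborel)))
     \<le> v\<^sup>2 / 2 * (\<integral>x. x\<^sup>2 * f x \<partial>lborel)"
proof -
  have [measurable]: "f \<in> borel_measurable borel" using f by simp
  have ci: "integrable lborel (\<lambda>x. cis (- (v * x)) * complex_of_real (f x))"
    using f by (intro integrable_cis_mult) auto
  have li: "integrable lborel (\<lambda>x. complex_of_real (f x) - \<i> * v * complex_of_real (x * f x))"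
    by (intro Bochner_Integration.integrable_diff integrable_mult_right integrable_of_real f f1)
  have "(\<integral>x. complex_of_real (f x) - \<i> * v * complex_of_real (x * f x) \<partial>lborel)
      = 1 - \<i> * v * (\<integral>x. x * f x \<partial>lborel)"
    using f f1 one by (subst Bochner_Integration.integral_diff) (auto simp del: of_real_mult)
  then have "fourier f (complex_of_real v) - (1 - \<i> * v * (\<integral>x. x * f x \<partial>lborel)) =
     (\<integral>x. cis (- (v * x)) * complex_of_real (f x) - (complex_of_real (f x) - \<i> * v * complex_of_real (x * f x)) \<partial>lborel)"
    unfolding fourier_of_real by (simp add: Bochner_Integration.integral_diff[OF ci li] del: of_real_mult)
  also have "norm \<dots> \<le> (\<integral>x. norm (cis (- (v * x)) * complex_of_real (f x) - (complex_of_real (f x) - \<i> * v * complex_of_real (x * f x))) \<partial>lborel)"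
    by (rule integral_norm_bound)
  also have "\<dots> \<le> (\<integral>x. v\<^sup>2 / 2 * (x\<^sup>2 * f x) \<partial>lborel)"
  proof (rule integral_mono)
    fix x
    have "cis (- (v * x)) * complex_of_real (f x) - (complex_of_real (f x) - \<i> * v * complex_of_real (x * f x))
        = (cis (- (v * x)) - (1 + \<i> * complex_of_real (- (v * x)))) * f x"
      by (simp add: algebra_simps)
    also have "norm \<dots> \<le> (- (v * x))\<^sup>2 / 2 * f x"
      using nonneg[of x] norm_cis_taylor[of "- (v * x)"] unfolding norm_mult
      by (intro mult_mono) auto
    finally show "norm (cis (- (v * x)) * complex_of_real (f x) - (complex_of_real (f x) - \<i> * v * complex_of_real (x * f x)))
      \<le> v\<^sup>2 / 2 * (x\<^sup>2 * f x)" by (simp add: power_mult_distrib)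
  qed (use f2 ci li in auto)
  finally show ?thesis by simp
qed

text \<open>If the modulus were 1, rotating by the phase \<open>\<theta>\<close> would make the
  nonnegative function \<open>f x - cos (- \<theta> - v * x) * f x\<close> have integral zero. The
  cosine equals 1 only on a countable set when \<open>v \<noteq> 0\<close>, so \<open>f\<close>
  would vanish almost everywhere, against its mass being 1.\<close>

lemma norm_fourier_less:
  assumes f: "integrable lborel f" and nonneg: "\<And>x. 0 \<le> f x" and one: "integral\<^sup>L lborel f = 1"
    and v: "v \<noteq> 0"
  shows "norm (fourier f (complex_of_real v)) < 1"
proof (rule ccontr)
  assume "\<not> ?thesis"
  then have n1: "norm (fourier f (complex_of_real v)) = 1"
    using norm_fourier_le[of f v] nonneg one by simp
  have [measurable]: "f \<in> borel_measurable borel" using f by simp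
  obtain \<theta> where \<theta>: "fourier f (complex_of_real v) = cis \<theta>"
    using n1 by (metis complex_unimodular_polar cis.ctr Complex_eq cis_conv_exp)
  have ci: "integrable lborel (\<lambda>x. cis (- \<theta> - v * x) * complex_of_real (f x))"
    using f by (intro integrable_cis_mult) auto
  have "(\<integral>x. cis (- \<theta> - v * x) * complex_of_real (f x) \<partial>lborel) =
      (\<integral>x. cis (- \<theta>) * (cis (- (v * x)) * complex_of_real (f x)) \<partial>lborel)"
    by (simp add: cis_mult mult.assoc[symmetric])
  also have "\<dots> = cis (- \<theta>) * cis \<theta>"
    unfolding \<theta>[symmetric] fourier_of_real by (rule integral_mult_right_zero)
  also have "\<dots> = 1" by (simp add: cis_mult)
  finally have "Re (\<integral>x. cis (- \<theta> - v * x) * complex_of_real (f x) \<partial>lborel) = 1" by simp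
  then have re: "(\<integral>x. cos (- \<theta> - v * x) * f x \<partial>lborel) = 1"
    using integral_Re[OF ci] by simp
  have rei: "integrable lborel (\<lambda>x. cos (- \<theta> - v * x) * f x)"
    using integrable_Re[OF ci] by simp
  have "(\<integral>x. f x - cos (- \<theta> - v * x) * f x \<partial>lborel) = 0"
    using f rei re one by simp
  moreover have ge: "0 \<le> f x - cos (- \<theta> - v * x) * f x" for x
    using mult_right_mono[OF cos_le_one nonneg[of x], of "- \<theta> - v * x"] by simp
  ultimately have "AE x in lborel. f x - cos (- \<theta> - v * x) * f x = 0"
    using f rei by (subst integral_nonneg_eq_0_iff_AE[symmetric]) auto
  moreover have "AE x in lborel. cos (- \<theta> - v * x) \<noteq> 1"
  proof -
    have "{x. cos (- \<theta> - v * x) = 1} \<subseteq> (\<lambda>n::int. (- \<theta> - n * 2 * pi) / v) ` UNIV"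
      using v by (auto simp: cos_one_2pi_int field_simps image_iff)
    then have "countable {x. cos (- \<theta> - v * x) = 1}"
      by (rule countable_subset) simp
    then have "{x. cos (- \<theta> - v * x) = 1} \<in> null_sets lborel"
      by (rule countable_imp_null_set_lborel)
    from AE_not_in[OF this] show ?thesis by simp
  qed
  ultimately have "AE x in lborel. f x = 0" by eventually_elim auto
  then have "integral\<^sup>L lborel f = 0"
    by (rule integral_eq_zero_AE)
  with one show False by simp
qed

text \<open>The Riemann--Lebesgue lemma handles large frequencies; on the remaining compact set the
  continuous modulus attains its maximum, which is below 1.\<close>

lemma norm_fourier_bounded_away:
  assumes f: "integrable lborel f" and cont: "continuous_on UNIV f"
    and nonneg: "\<And>x. 0 \<le> f x" and one: "integral\<^sup>L lborel f = 1" and \<eta>: "\<eta> > 0"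
  obtains \<delta> where "\<delta> > 0" "\<And>v. \<eta> \<le> \<bar>v\<bar> \<Longrightarrow> norm (fourier f (complex_of_real v)) \<le> 1 - \<delta>"
proof -
  let ?\<phi> = "\<lambda>v. fourier f (complex_of_real v)"
  have "((\<lambda>t. \<integral>x. cis (t * x) * complex_of_real (f x) \<partial>lborel) \<longlongrightarrow> 0) at_infinity"
    using f cont by (intro Riemann_Lebesgue) (auto simp: continuous_on_eq_continuous_at intro!: AE_I2 continuous_intros)
  from tendsto_norm_zero[OF this] have "\<forall>\<^sub>F t in at_infinity. norm (\<integral>x. cis (t * x) * complex_of_real (f x) \<partial>lborel) < 1 / 2"
    by (rule order_tendstoD) simp
  then obtain N where N: "\<And>t. \<bar>t\<bar> \<ge> N \<Longrightarrow> norm (\<integral>x. cis (t * x) * complex_of_real (f x) \<partial>lborel) < 1 / 2"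
    unfolding eventually_at_infinity real_norm_def by blast
  have far: "norm (?\<phi> v) \<le> 1 / 2" if "\<bar>v\<bar> \<ge> N" for v
    using N[of "- v"] that by (simp add: fourier_of_real)
  \<comment> \<open>The middle range is empty when every frequency beyond \<open>\<eta>\<close> is
    already large. That case is split off because a maximum exists only on a nonempty set.\<close>
  let ?S = "cball 0 N - ball 0 \<eta> :: real set"
  show thesis
  proof (cases "?S = {}")
    case True
    have "N \<le> \<bar>v\<bar>" if "\<eta> \<le> \<bar>v\<bar>" for v
    proof (rule ccontr)
      assume "\<not> N \<le> \<bar>v\<bar>"
      with that have "v \<in> ?S" by simp
      with True show False by blast
    qed
    then show thesis using that[of "1 / 2"] far by simp
  next
    case False
    have "compact ?S" by (intro compact_diff) auto
    moreover have "continuous_on ?S (\<lambda>v. norm (?\<phi> v))"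
      using continuous_fourier[OF f] by (intro continuous_at_imp_continuous_on continuous_intros) auto
    ultimately obtain w where w: "w \<in> ?S" "\<And>v. v \<in> ?S \<Longrightarrow> norm (?\<phi> v) \<le> norm (?\<phi> w)"
      using continuous_attains_sup[OF _ False] by metis
    have "w \<noteq> 0" using w(1) \<eta> by auto
    then have "norm (?\<phi> w) < 1" using norm_fourier_less[OF f nonneg one] by blast
    moreover have "norm (?\<phi> v) \<le> 1 - min (1 / 2) (1 - norm (?\<phi> w))" if "\<eta> \<le> \<bar>v\<bar>" for v
    proof (cases "\<bar>v\<bar> \<ge> N")
      case True
      then show ?thesis using far[of v] by simp
    next
      case False
      with that have "v \<in> ?S" by simp
      then show ?thesis using w(2)[of v] by simp
    qed
    ultimately show thesis using that[of "min (1 / 2) (1 - norm (?\<phi> w))"] by simp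
  qed
qed

section \<open>The renewal density theorem\<close>

text \<open>With \<open>w = (1 - r) + \<i> \<mu> v\<close> the two denominators agree to first order:
  \<open>1 - r \<phi> v = r w + O(\<bar>w\<bar>\<^sup>2)\<close>, so the poles at \<open>v = 0\<close> cancel as \<open>r \<rightarrow> 1\<close>.\<close>

lemma pole_difference_bounded:
  fixes \<phi> :: "real \<Rightarrow> complex" and \<mu> S :: real
  assumes \<mu>: "\<mu> > 0" and S: "S \<ge> 0"
    and taylor: "\<And>v. norm (\<phi> v - (1 - \<i> * v * \<mu>)) \<le> v\<^sup>2 / 2 * S"
    and le1: "\<And>v. norm (\<phi> v) \<le> 1"
    and away: "\<And>\<eta>. \<eta> > 0 \<Longrightarrow> \<exists>\<delta>>0. \<forall>v. \<eta> \<le> \<bar>v\<bar> \<longrightarrow> norm (\<phi> v) \<le> 1 - \<delta>"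
  obtains K where "\<And>(v::real) (r::real). v \<noteq> 0 \<Longrightarrow> 1 / 2 \<le> r \<Longrightarrow> r < 1 \<Longrightarrow>
    norm (complex_of_real r / (1 - complex_of_real r * \<phi> v) - 1 / (complex_of_real (1 - r) + \<i> * \<mu> * v)) \<le> K"
proof -
  \<comment> \<open>\<open>K0\<close> absorbs both second-order errors, using \<open>v\<^sup>2 / 2 *
    S = S / (2 * \<mu>\<^sup>2) * (\<mu>\<^sup>2 * v\<^sup>2)\<close>. The radius
    \<open>\<omega>\<close> satisfies \<open>K0 * \<omega> = 1 / 4\<close>, so within it the error
    is at most \<open>norm w / 4\<close>, half of the lower bound \<open>norm w / 2\<close> for
    \<open>norm (r * w)\<close>.\<close>
  define K0 where "K0 = 1 + S / (2 * \<mu>\<^sup>2)"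
  define \<omega> where "\<omega> = 1 / (4 * K0)"
  have K0: "K0 \<ge> 1" using S by (simp add: K0_def)
  then have \<omega>: "\<omega> > 0" "K0 * \<omega> = 1 / 4" by (simp_all add: \<omega>_def)
  obtain \<delta> where \<delta>: "\<delta> > 0" "\<And>v. \<omega> / (2 * \<mu>) \<le> \<bar>v\<bar> \<Longrightarrow> norm (\<phi> v) \<le> 1 - \<delta>"
    using away[of "\<omega> / (2 * \<mu>)"] \<omega> \<mu> by auto
  show thesis
  proof (rule that[of "4 * K0 + 1 / min \<delta> (\<omega> / 2)"])
    fix v r :: real assume v: "v \<noteq> 0" and r: "1 / 2 \<le> r" "r < 1"
    define w where "w = complex_of_real (1 - r) + \<i> * \<mu> * v"
    define d where "d = 1 - r * \<phi> v"
    have w0: "norm w > 0" using r by (auto simp: w_def complex_eq_iff)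
    have w2: "(norm w)\<^sup>2 = (1 - r)\<^sup>2 + \<mu>\<^sup>2 * v\<^sup>2"
      by (simp add: w_def cmod_power2 power_mult_distrib)
    \<comment> \<open>The constant and linear parts cancel up to \<open>(1 - r)\<^sup>2\<close>;
      only the Taylor remainder of \<open>\<phi>\<close> is left besides it.\<close>
    have e_eq: "r * w - d = r * (\<phi> v - (1 - \<i> * v * \<mu>)) - complex_of_real ((1 - r)\<^sup>2)"
      by (simp add: w_def d_def algebra_simps power2_eq_square)
    have "norm (r * w - d) \<le> norm (r * (\<phi> v - (1 - \<i> * v * \<mu>))) + norm (complex_of_real ((1 - r)\<^sup>2))"
      unfolding e_eq by (rule norm_triangle_ineq4)
    also have "\<dots> \<le> 1 * (v\<^sup>2 / 2 * S) + (1 - r)\<^sup>2"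
    proof (rule add_mono)
      show "norm (r * (\<phi> v - (1 - \<i> * v * \<mu>))) \<le> 1 * (v\<^sup>2 / 2 * S)"
        unfolding norm_mult using taylor[of v] r by (intro mult_mono) auto
    qed (simp only: norm_of_real, simp)
    also have "\<dots> \<le> K0 * (norm w)\<^sup>2"
    proof -
      have "K0 * (norm w)\<^sup>2 = (1 - r)\<^sup>2 + \<mu>\<^sup>2 * v\<^sup>2 + S / (2 * \<mu>\<^sup>2) * (1 - r)\<^sup>2 + v\<^sup>2 / 2 * S"
        unfolding w2 K0_def using \<mu> by (simp add: field_simps)
      moreover have "0 \<le> \<mu>\<^sup>2 * v\<^sup>2 + S / (2 * \<mu>\<^sup>2) * (1 - r)\<^sup>2" using S by simp
      ultimately show ?thesis by linarith
    qed
    finally have e: "norm (r * w - d) \<le> K0 * (norm w)\<^sup>2" .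
    \<comment> \<open>For small \<open>w\<close> the common denominator is at least
      \<open>(norm w)\<^sup>2 / 4\<close>, which cancels the quadratic error and leaves
      \<open>4 * K0\<close>. Otherwise \<open>1 - r\<close> or \<open>\<mu> * \<bar>v\<bar>\<close>
      is at least \<open>\<omega> / 2\<close>, so each fraction is bounded separately, with
      \<open>1 / \<omega> = 4 * K0\<close>.\<close>
    have "norm (r / d - 1 / w) \<le> 4 * K0 + 1 / min \<delta> (\<omega> / 2)"
    proof (cases "norm w \<le> \<omega>")
      case True
      have "K0 * (norm w)\<^sup>2 = (K0 * norm w) * norm w" by (simp add: power2_eq_square)
      also have "\<dots> \<le> (K0 * norm w) * \<omega>" using True K0 by (intro mult_left_mono) auto
      also have "\<dots> = norm w * (K0 * \<omega>)" by simp
      also have "\<dots> = norm w / 4" using \<omega> by simp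
      finally have "K0 * (norm w)\<^sup>2 \<le> norm w / 4" .
      moreover have "norm w / 2 \<le> norm (r * w)" using r w0 by (simp add: norm_mult)
      moreover have "norm (r * w) \<le> norm (r * w - d) + norm d"
        using norm_triangle_ineq[of "r * w - d" d] by simp
      ultimately have d: "norm w / 4 \<le> norm d" using e by linarith
      then have "d \<noteq> 0" using w0 by auto
      then have "r / d - 1 / w = (r * w - d) / (d * w)"
        using w0 by (simp add: field_simps)
      then have "norm (r / d - 1 / w) = norm (r * w - d) / (norm d * norm w)"
        by (simp add: norm_divide norm_mult)
      also have "\<dots> \<le> (K0 * (norm w)\<^sup>2) / (norm w / 4 * norm w)"
        using e d w0 K0 by (intro frac_le mult_right_mono) auto
      also have "\<dots> = 4 * K0" using w0 by (simp add: power2_eq_square)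
      also have "\<dots> \<le> 4 * K0 + 1 / min \<delta> (\<omega> / 2)" using \<delta> \<omega> by simp
      finally show ?thesis .
    next
      case False
      have "norm w \<le> (1 - r) + \<mu> * \<bar>v\<bar>"
        unfolding w_def using norm_triangle_ineq[of "complex_of_real (1 - r)" "\<i> * \<mu> * v"] r \<mu>
        by (simp add: norm_mult del: of_real_diff)
      then have or: "\<omega> / 2 \<le> 1 - r \<or> \<omega> / 2 \<le> \<mu> * \<bar>v\<bar>" using False by linarith
      have "norm (r * \<phi> v) = r * norm (\<phi> v)" using r by (simp add: norm_mult)
      then have d1: "1 - r * norm (\<phi> v) \<le> norm d"
        unfolding d_def using norm_triangle_ineq2[of 1 "r * \<phi> v"] by simp
      have d: "min \<delta> (\<omega> / 2) \<le> norm d"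
        using or
      proof
        assume "\<omega> / 2 \<le> 1 - r"
        moreover have "r * norm (\<phi> v) \<le> r" using le1[of v] r by (simp add: mult_left_le)
        ultimately show ?thesis using d1 by linarith
      next
        assume "\<omega> / 2 \<le> \<mu> * \<bar>v\<bar>"
        then have "norm (\<phi> v) \<le> 1 - \<delta>" using \<mu> by (intro \<delta>(2)) (simp add: field_simps)
        moreover have "r * norm (\<phi> v) \<le> norm (\<phi> v)" using r by (intro mult_left_le_one_le) auto
        ultimately show ?thesis using d1 by linarith
      qed
      have "norm (r / d) \<le> 1 / min \<delta> (\<omega> / 2)"
        using d r \<delta> \<omega> by (auto simp: norm_divide intro!: frac_le)
      moreover have "norm (1 / w) \<le> 1 / \<omega>"
        using False \<omega> by (auto simp: norm_divide intro!: frac_le)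
      moreover have "1 / \<omega> = 4 * K0" by (simp add: \<omega>_def)
      ultimately show ?thesis using norm_triangle_ineq4[of "r / d" "1 / w"] by linarith
    qed
    then show "norm (complex_of_real r / (1 - complex_of_real r * \<phi> v) - 1 / (complex_of_real (1 - r) + \<i> * \<mu> * v)) \<le> 4 * K0 + 1 / min \<delta> (\<omega> / 2)"
      by (simp add: w_def d_def)
  qed
qed

text \<open>Each convolution power has an integrable transform, but the summed factor
  \<open>1 / (1 - \<phi> v)\<close> is singular at 0. The sum is therefore weighted by powers of
  \<open>r < 1\<close>, the pole is subtracted, and only then is \<open>r\<close> sent to 1.\<close>

theorem renewal_density_theorem:
  assumes f: "integrable lborel f" and cont: "continuous_on UNIV f"
    and nonneg: "\<And>x. 0 \<le> f x" and bound: "\<And>x. f x \<le> M" and one: "integral\<^sup>L lborel f = 1"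
    and f1: "integrable lborel (\<lambda>x. x * f x)" and f2: "integrable lborel (\<lambda>x. x\<^sup>2 * f x)"
    and mean: "0 < (\<integral>x. x * f x \<partial>lborel)"
    and L1: "integrable lborel (\<lambda>v. fourier f (complex_of_real v))"
    and summ: "\<And>x. summable (\<lambda>k. conv_power f (Suc k) x)"
  shows "((\<lambda>x. \<Sum>k. conv_power f (Suc k) x) \<longlongrightarrow> 1 / (\<integral>x. x * f x \<partial>lborel)) at_top"
proof -
  define \<mu> where "\<mu> = (\<integral>x. x * f x \<partial>lborel)"
  define \<phi> where "\<phi> v = fourier f (complex_of_real v)" for v :: real
  define \<psi> where "\<psi> v = \<phi> v / (2 * pi)" for v
  \<comment> \<open>As \<open>s\<close> decreases to 0, \<open>g s\<close> tends to the indicator of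
    the positive half-line, so its convolution with \<open>f\<close> tends to the distribution
    function of \<open>f\<close>.\<close>
  define g where "g s x = indicator {0<..} x * exp (- s * x)" for s x :: real
  define D where "D r v = complex_of_real r / (1 - complex_of_real r * \<phi> v) - 1 / (complex_of_real (1 - r) + \<i> * \<mu> * v)" for r v :: real
  define u where "u r x = (\<Sum>k. r ^ Suc k * conv_power f (Suc k) x)" for r x
  have \<mu>: "\<mu> > 0" using mean by (simp add: \<mu>_def)
  have fM[measurable]: "f \<in> borel_measurable borel" using f by simp
  have \<psi>: "integrable lborel \<psi>" using L1 by (simp add: \<psi>_def[abs_def] \<phi>_def)
  have [measurable]: "\<phi> \<in> borel_measurable borel" "\<psi> \<in> borel_measurable borel"
    using L1 \<psi> by (auto simp: \<phi>_def[abs_def])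
  have le1: "norm (\<phi> v) \<le> 1" for v
    using norm_fourier_le[of f v] nonneg one by (simp add: \<phi>_def)
  have lt1: "norm (\<phi> v) < 1" if "v \<noteq> 0" for v
    using norm_fourier_less[OF f nonneg one that] by (simp add: \<phi>_def)
  obtain K where K: "\<And>v r. v \<noteq> 0 \<Longrightarrow> 1 / 2 \<le> r \<Longrightarrow> r < 1 \<Longrightarrow> norm (D r v) \<le> K"
  proof (rule pole_difference_bounded[of \<mu> "\<integral>x. x\<^sup>2 * f x \<partial>lborel" \<phi>])
    show "0 \<le> (\<integral>x. x\<^sup>2 * f x \<partial>lborel)" using nonneg by simp
    show "norm (\<phi> v - (1 - \<i> * v * \<mu>)) \<le> v\<^sup>2 / 2 * (\<integral>x. x\<^sup>2 * f x \<partial>lborel)" for v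
      unfolding \<phi>_def \<mu>_def by (rule fourier_taylor[OF f nonneg one f1 f2])
    show "\<exists>\<delta>>0. \<forall>v. \<eta> \<le> \<bar>v\<bar> \<longrightarrow> norm (\<phi> v) \<le> 1 - \<delta>" if "\<eta> > 0" for \<eta>
      using norm_fourier_bounded_away[OF f cont nonneg one that] unfolding \<phi>_def by metis
  qed (use \<mu> le1 that in \<open>auto simp: D_def\<close>)

  have inv: "complex_of_real (f x) = (\<integral>v. cis (v * x) * \<psi> v \<partial>lborel)" for x
    unfolding \<psi>_def \<phi>_def using nonneg bound by (intro fourier_inversion[OF f cont _ L1]) auto
  have pow_int: "integrable lborel (\<lambda>v. \<phi> v ^ k * \<psi> v)" for k
  proof (rule Bochner_Integration.integrable_bound[OF \<psi>])
    show "AE v in lborel. norm (\<phi> v ^ k * \<psi> v) \<le> norm (\<psi> v)"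
      using le1 by (auto simp: norm_mult norm_power intro!: mult_left_le_one_le power_le_one)
  qed simp
  \<comment> \<open>One of the \<open>k + 1\<close> factors of the transform sits in
    \<open>\<psi>\<close>, together with \<open>1 / (2 * pi)\<close>. It provides integrability,
    while the remaining \<open>k\<close> factors are bounded by 1.\<close>
  have pow: "complex_of_real (conv_power f (Suc k) x) = (\<integral>v. cis (v * x) * (\<phi> v ^ k * \<psi> v) \<partial>lborel)" for k x
  proof (induction k arbitrary: x)
    case (Suc k)
    show ?case
      using convolution_inverse_transform[OF f pow_int Suc]
      by (simp add: \<phi>_def mult.assoc)
  qed (simp add: inv)

  \<comment> \<open>For \<open>r < 1\<close> the terms are dominated by
    \<open>r ^ k * norm (\<psi> v)\<close>, so sum and integral may be exchanged and the geometric
    series summed pointwise.\<close>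
  have u_eq: "complex_of_real (u r x) = (\<integral>v. cis (v * x) * (r / (1 - r * \<phi> v) * \<psi> v) \<partial>lborel)"
    if r: "0 \<le> r" "r < 1" for r x
  proof -
    let ?F = "\<lambda>k v. complex_of_real r ^ Suc k * (cis (v * x) * (\<phi> v ^ k * \<psi> v))"
    have nF: "norm (?F k v) \<le> r ^ k * norm (\<psi> v)" for k v
    proof -
      have "r * norm (\<phi> v) ^ k \<le> 1 * 1" using r le1 by (intro mult_mono power_le_one) auto
      then have "r ^ k * (r * norm (\<phi> v) ^ k) * norm (\<psi> v) \<le> r ^ k * 1 * norm (\<psi> v)"
        using r by (intro mult_right_mono mult_left_mono) auto
      then show ?thesis using r by (simp add: norm_mult norm_power mult_ac)
    qed
    have sr: "summable (\<lambda>k. r ^ k * z)" for z using r by (intro summable_mult2) (simp add: summable_geometric)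
    have Fi: "integrable lborel (?F k)" for k
      by (intro integrable_mult_right integrable_cis_mult pow_int) auto
    have "(\<lambda>k. integral\<^sup>L lborel (?F k)) sums (\<integral>v. (\<Sum>k. ?F k v) \<partial>lborel)"
    proof (rule sums_integral[OF Fi])
      show "AE v in lborel. summable (\<lambda>k. norm (?F k v))"
        using nF sr by (intro AE_I2 summable_comparison_test'[OF sr]) auto
      have "(\<integral>v. norm (?F k v) \<partial>lborel) \<le> (\<integral>v. r ^ k * norm (\<psi> v) \<partial>lborel)" for k
        using nF Fi \<psi> by (intro integral_mono) auto
      then show "summable (\<lambda>k. \<integral>v. norm (?F k v) \<partial>lborel)"
        by (intro summable_comparison_test'[OF sr[of "\<integral>v. norm (\<psi> v) \<partial>lborel"]]) auto
    qed
    moreover have "(\<Sum>k. ?F k v) = cis (v * x) * (r / (1 - r * \<phi> v) * \<psi> v)" for v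
    proof -
      have "norm (r * \<phi> v) < 1"
        using mult_mono[of r r "norm (\<phi> v)" 1] le1[of v] r by (auto simp: norm_mult)
      from sums_mult[OF geometric_sums[OF this], of "r * (cis (v * x) * \<psi> v)"]
      show ?thesis by (intro sums_unique[symmetric]) (simp add: power_mult_distrib mult_ac)
    qed
    moreover have "integral\<^sup>L lborel (?F k) = complex_of_real (r ^ Suc k * conv_power f (Suc k) x)" for k
      unfolding integral_mult_right_zero pow[symmetric] by simp
    ultimately have "(\<lambda>k. complex_of_real (r ^ Suc k * conv_power f (Suc k) x))
        sums (\<integral>v. cis (v * x) * (r / (1 - r * \<phi> v) * \<psi> v) \<partial>lborel)"
      by (simp only:)
    note S = this
    from sums_summable[OF S] have "summable (\<lambda>k. r ^ Suc k * conv_power f (Suc k) x)"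
      by (simp only: summable_of_real_iff)
    from sums_of_real[OF summable_sums[OF this], where 'a=complex] show ?thesis
      unfolding u_def using S by (rule sums_unique2)
  qed

  have g_eq: "complex_of_real (Defs.convolution (g s) f x) = (\<integral>v. cis (v * x) * (1 / (s + \<i> * v) * \<psi> v) \<partial>lborel)"
    if "s > 0" for s x
    using convolution_inverse_transform[OF integrable_exp_halfline[OF that] \<psi> inv, of x]
    unfolding fourier_exp_halfline[OF that] g_def[abs_def] by simp

  \<comment> \<open>The damping rate \<open>(1 - r) / \<mu>\<close> is chosen so that
    \<open>1 / (s + \<i> * v) / \<mu>\<close> equals the subtracted fraction
    \<open>1 / ((1 - r) + \<i> * \<mu> * v)\<close>.\<close>
  have main: "complex_of_real (u r x - Defs.convolution (g ((1 - r) / \<mu>)) f x / \<mu>)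
      = (\<integral>v. cis (v * x) * (D r v * \<psi> v) \<partial>lborel)" if r: "0 \<le> r" "r < 1" for r x
  proof -
    have s: "(1 - r) / \<mu> > 0" using r \<mu> by simp
    \<comment> \<open>The separate bounds \<open>1 / (1 - r)\<close> here and
      \<open>\<mu> / (1 - r)\<close> in \<open>i2\<close> suffice for fixed \<open>r\<close> but
      blow up as \<open>r\<close> tends to 1; the uniform bound \<open>K\<close> is available for
      the difference.\<close>
    have i1: "integrable lborel (\<lambda>v. cis (v * x) * (r / (1 - r * \<phi> v) * \<psi> v))"
    proof (intro integrable_cis_mult Bochner_Integration.integrable_bound[OF integrable_mult_right[OF \<psi>, of "1 / (1 - r)"]])
      have "norm (r / (1 - r * \<phi> v)) \<le> 1 / (1 - r)" for v
      proof -
        have "r * norm (\<phi> v) \<le> r" using le1[of v] r by (simp add: mult_left_le)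
        then have "1 - r \<le> norm (1 - r * \<phi> v)"
          using norm_triangle_ineq2[of 1 "r * \<phi> v"] r by (simp add: norm_mult)
        then show ?thesis using r by (auto simp: norm_divide intro!: frac_le)
      qed
      then have "norm (r / (1 - r * \<phi> v) * \<psi> v) \<le> 1 / (1 - r) * norm (\<psi> v)" for v
        unfolding norm_mult by (intro mult_right_mono) auto
      then show "AE v in lborel. norm (r / (1 - r * \<phi> v) * \<psi> v) \<le> norm (1 / (1 - r) * \<psi> v)"
        using r by (simp add: norm_mult norm_divide del: of_real_diff flip: of_real_diff)
    qed auto
    have i2: "integrable lborel (\<lambda>v. cis (v * x) * (1 / ((1 - r) / \<mu> + \<i> * v) * \<psi> v))"
    proof (intro integrable_cis_mult Bochner_Integration.integrable_bound[OF integrable_mult_right[OF \<psi>, of "1 / ((1 - r) / \<mu>)"]])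
      have "norm (1 / (s + \<i> * v)) \<le> 1 / s" if "s > 0" for s v :: real
        using that abs_Re_le_cmod[of "s + \<i> * v"] by (auto simp: norm_divide intro!: frac_le)
      from this[OF s] have "norm (1 / ((1 - r) / \<mu> + \<i> * v) * \<psi> v) \<le> 1 / ((1 - r) / \<mu>) * norm (\<psi> v)" for v
        unfolding norm_mult by (intro mult_right_mono) auto
      then show "AE v in lborel. norm (1 / ((1 - r) / \<mu> + \<i> * v) * \<psi> v) \<le> norm (1 / ((1 - r) / \<mu>) * \<psi> v)"
        using r \<mu> by (simp add: norm_mult norm_divide del: of_real_diff flip: of_real_diff)
    qed auto
    have D_eq: "D r v = r / (1 - r * \<phi> v) - 1 / ((1 - r) / \<mu> + \<i> * v) / \<mu>" for v
    proof -
      have "(1 - complex_of_real r) / complex_of_real \<mu> + \<i> * complex_of_real v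
          = (1 - complex_of_real r + \<i> * \<mu> * v) / complex_of_real \<mu>"
        using \<mu> by (simp add: add_divide_distrib)
      then show ?thesis using \<mu> by (simp add: D_def)
    qed
    have "complex_of_real (u r x - Defs.convolution (g ((1 - r) / \<mu>)) f x / \<mu>)
      = (\<integral>v. cis (v * x) * (r / (1 - r * \<phi> v) * \<psi> v) \<partial>lborel) -
        (\<integral>v. cis (v * x) * (1 / ((1 - r) / \<mu> + \<i> * v) * \<psi> v) \<partial>lborel) / \<mu>"
      using u_eq[OF r] g_eq[OF s] by simp
    also have "\<dots> = (\<integral>v. cis (v * x) * (r / (1 - r * \<phi> v) * \<psi> v) -
        cis (v * x) * (1 / ((1 - r) / \<mu> + \<i> * v) * \<psi> v) / \<mu> \<partial>lborel)"
      by (subst integral_divide_zero[symmetric])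
         (intro Bochner_Integration.integral_diff[symmetric] i1 integrable_divide_zero i2)
    also have "\<dots> = (\<integral>v. cis (v * x) * (D r v * \<psi> v) \<partial>lborel)"
      by (intro Bochner_Integration.integral_cong) (auto simp: D_eq algebra_simps diff_divide_distrib)
    finally show ?thesis .
  qed
  define U where "U x = (\<Sum>k. conv_power f (Suc k) x)" for x
  \<comment> \<open>Both denominators vanish at \<open>v = 0\<close>, where division by zero makes
    \<open>D1\<close> equal to 0. The limits and continuity below are accordingly stated almost
    everywhere.\<close>
  define D1 where "D1 v = 1 / (1 - \<phi> v) - 1 / (\<i> * \<mu> * v)" for v :: real
  define \<rho> where "\<rho> n = 1 - 1 / real (Suc (Suc n))" for n
  have \<rho>: "1 / 2 \<le> \<rho> n" "0 \<le> \<rho> n" "\<rho> n < 1" for n by (auto simp: \<rho>_def field_simps)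
  have \<rho>1: "\<rho> \<longlonglongrightarrow> 1"
    using tendsto_diff[OF tendsto_const LIMSEQ_Suc[OF LIMSEQ_inverse_real_of_nat], of 1]
    by (simp add: \<rho>_def[abs_def] inverse_eq_divide)
  have D_lim: "(\<lambda>n. D (\<rho> n) v) \<longlonglongrightarrow> D1 v" if "v \<noteq> 0" for v
  proof -
    have "1 - \<phi> v \<noteq> 0" using lt1[OF that] by auto
    then have "(\<lambda>n. D (\<rho> n) v) \<longlonglongrightarrow> complex_of_real 1 / (1 - complex_of_real 1 * \<phi> v) - 1 / (complex_of_real (1 - 1) + \<i> * \<mu> * v)"
      unfolding D_def using that \<mu> by (intro tendsto_intros \<rho>1) auto
    then show ?thesis by (simp add: D1_def)
  qed
  have D_meas[measurable]: "D r \<in> borel_measurable borel" "D1 \<in> borel_measurable borel" for r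
    unfolding D_def[abs_def] D1_def[abs_def] by measurable
  have dom: "AE v in lborel. norm (cis (v * x) * (D (\<rho> n) v * \<psi> v)) \<le> K * norm (\<psi> v)" for x n
    using AE_lborel_singleton[of 0]
    by eventually_elim (use K \<rho> in \<open>auto simp: norm_mult intro!: mult_right_mono\<close>)
  have lim: "AE v in lborel. (\<lambda>n. cis (v * x) * (D (\<rho> n) v * \<psi> v)) \<longlonglongrightarrow> cis (v * x) * (D1 v * \<psi> v)" for x
    using AE_lborel_singleton[of 0]
    by eventually_elim (intro tendsto_intros D_lim)
  \<comment> \<open>At \<open>x = 0\<close> the oscillating factor is 1, so the dominated limit is
    the bare product \<open>D1 v * \<psi> v\<close>.\<close>
  have D1_int: "integrable lborel (\<lambda>v. D1 v * \<psi> v)"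
    using integrable_dominated_convergence[OF _ _ _ lim[of 0] dom[of 0]] \<psi> by simp

  have diff: "complex_of_real (U x - (\<integral>y. indicator {0<..} (x - y) * f y \<partial>lborel) / \<mu>)
      = (\<integral>v. cis (v * x) * (D1 v * \<psi> v) \<partial>lborel)" for x
  proof -
    \<comment> \<open>Abel summation back to \<open>r = 1\<close>: the convergent series of
      nonnegative convolution powers is itself the majorant.\<close>
    have "(\<lambda>n. u (\<rho> n) x) \<longlonglongrightarrow> (\<Sum>k. 1 ^ Suc k * conv_power f (Suc k) x)"
      unfolding u_def
    proof (rule tannerys_theorem[THEN conjunct2, THEN conjunct2, OF _ _ summ[of x]])
      show "\<forall>\<^sub>F (k, n) in at_top \<times>\<^sub>F at_top. norm (\<rho> n ^ Suc k * conv_power f (Suc k) x) \<le> conv_power f (Suc k) x"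
        using \<rho> conv_power_nonneg[OF nonneg]
        by (intro always_eventually) (auto simp: abs_mult less_imp_le intro!: mult_left_le_one_le mult_le_one power_le_one simp del: conv_power.simps)
    qed (intro tendsto_intros \<rho>1, simp)
    then have 1: "(\<lambda>n. u (\<rho> n) x) \<longlonglongrightarrow> U x" by (simp add: U_def)
    have 2: "(\<lambda>n. Defs.convolution (g ((1 - \<rho> n) / \<mu>)) f x) \<longlonglongrightarrow> (\<integral>y. indicator {0<..} (x - y) * f y \<partial>lborel)"
      unfolding Defs.convolution_def
    proof (rule integral_dominated_convergence[where w=f])
      have "(\<lambda>n. g ((1 - \<rho> n) / \<mu>) z) \<longlonglongrightarrow> indicator {0<..} z * exp (- ((1 - 1) / \<mu>) * z)" for z
        unfolding g_def using \<mu> by (intro tendsto_intros \<rho>1) auto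
      then show "AE y in lborel. (\<lambda>n. g ((1 - \<rho> n) / \<mu>) (x - y) * f y) \<longlonglongrightarrow> indicator {0<..} (x - y) * f y"
        by (intro AE_I2 tendsto_intros) simp
      have "\<bar>g s z\<bar> \<le> 1" if "s \<ge> 0" for s z
        using that by (auto simp: g_def indicator_def)
      then show "AE y in lborel. norm (g ((1 - \<rho> n) / \<mu>) (x - y) * f y) \<le> f y" for n
        using \<rho>[of n] \<mu> nonneg by (auto simp: abs_mult intro!: mult_left_le_one_le)
    qed (auto simp: f g_def)
    have "(\<lambda>n. complex_of_real (u (\<rho> n) x - Defs.convolution (g ((1 - \<rho> n) / \<mu>)) f x / \<mu>))
        \<longlonglongrightarrow> complex_of_real (U x - (\<integral>y. indicator {0<..} (x - y) * f y \<partial>lborel) / \<mu>)"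
      using \<mu> by (intro tendsto_intros 1 2) auto
    moreover have "(\<lambda>n. \<integral>v. cis (v * x) * (D (\<rho> n) v * \<psi> v) \<partial>lborel) \<longlonglongrightarrow> (\<integral>v. cis (v * x) * (D1 v * \<psi> v) \<partial>lborel)"
      using \<psi> by (intro integral_dominated_convergence[OF _ _ _ lim dom]) auto
    ultimately show ?thesis
      unfolding main[OF \<rho>(2,3)] by (rule LIMSEQ_unique)
  qed

  have "((\<lambda>x. \<integral>v. cis (x * v) * (D1 v * \<psi> v) \<partial>lborel) \<longlongrightarrow> 0) at_infinity"
  proof (rule Riemann_Lebesgue[OF D1_int])
    have "isCont \<phi> v" for v unfolding \<phi>_def[abs_def] by (rule continuous_fourier[OF f])
    moreover have "1 - \<phi> v \<noteq> 0" if "v \<noteq> 0" for v using lt1[OF that] by auto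
    ultimately have D1_cont: "isCont (\<lambda>v. D1 v * \<psi> v) v" if "v \<noteq> 0" for v
      unfolding D1_def \<psi>_def using that \<mu> by (intro continuous_intros) auto
    show "AE v in lborel. isCont (\<lambda>v. D1 v * \<psi> v) v"
      by (rule eventually_mono[OF AE_lborel_singleton[of 0] D1_cont])
  qed
  then have "((\<lambda>x. complex_of_real (U x - (\<integral>y. indicator {0<..} (x - y) * f y \<partial>lborel) / \<mu>)) \<longlongrightarrow> of_real 0) at_top"
    unfolding diff using tendsto_mono[OF at_top_le_at_infinity] by (simp add: mult.commute)
  then have "((\<lambda>x. U x - (\<integral>y. indicator {0<..} (x - y) * f y \<partial>lborel) / \<mu>) \<longlongrightarrow> 0) at_top"
    unfolding tendsto_of_real_iff .
  \<comment> \<open>The distribution function of \<open>f\<close> tends to its total mass, which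
    accounts for the limit \<open>1 / \<mu>\<close>.\<close>
  moreover have "((\<lambda>x. \<integral>y. indicator {0<..} (x - y) * f y \<partial>lborel) \<longlongrightarrow> integral\<^sup>L lborel f) at_top"
  proof (rule integral_dominated_convergence_at_top[where w=f])
    show "AE y in lborel. ((\<lambda>x. indicator {0<..} (x - y) * f y) \<longlongrightarrow> f y) at_top"
    proof (intro AE_I2 tendsto_eventually)
      show "\<forall>\<^sub>F x in at_top. indicator {0<..} (x - y) * f y = f y" for y
        using eventually_gt_at_top[of y] by eventually_elim simp
    qed
    show "\<forall>\<^sub>F x in at_top. AE y in lborel. norm (indicator {0<..} (x - y) * f y) \<le> f y"
      using nonneg by (intro always_eventually allI AE_I2) (auto simp: indicator_def)
  qed (auto simp: f)
  ultimately have "((\<lambda>x. (U x - (\<integral>y. indicator {0<..} (x - y) * f y \<partial>lborel) / \<mu>) + (\<integral>y. indicator {0<..} (x - y) * f y \<partial>lborel) / \<mu>) \<longlongrightarrow> 0 + 1 / \<mu>) at_top"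
    unfolding one using \<mu> by (intro tendsto_intros) auto
  then show ?thesis by (simp add: U_def \<mu>_def)
qed

section \<open>Exponentially decaying kernels\<close>

lemma integrable_exp_minus_abs:
  assumes "s > 0"
  shows "integrable lborel (\<lambda>x::real. exp (- s * \<bar>x\<bar>))"
proof (rule Bochner_Integration.integrable_bound)
  let ?h = "\<lambda>x::real. indicator {0<..} x * exp (- s * x) :: real"
  have h: "integrable lborel ?h" by (rule integrable_exp_halfline[OF assms])
  have "integrable lborel (\<lambda>x. ?h (0 - x))"
    using h by (rule integrable_reflect_shift_iff[THEN iffD2])
  with h show "integrable lborel (\<lambda>x. ?h x + ?h (0 - x))" by (rule Bochner_Integration.integrable_add)
  show "AE x in lborel. norm (exp (- s * \<bar>x\<bar>)) \<le> norm (?h x + ?h (0 - x))"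
    using AE_lborel_singleton[of 0] by eventually_elim (auto simp: indicator_def)
qed simp

locale decaying_kernel =
  fixes a :: "real \<Rightarrow> real" and c :: real
  assumes nonneg: "\<And>x. 0 \<le> a x"
    and bounded: "bounded (range a)"
    and cont: "continuous_on UNIV a"
    and even: "\<And>x. a (- x) = a x"
    and integrable: "integrable lborel a"
    and integral: "integral\<^sup>L lborel a = 1"
    and c_pos: "0 < c"
    and decay: "((\<lambda>x. ln (a x) / \<bar>x\<bar>) \<longlongrightarrow> - c) at_infinity"
begin

section \<open>Pointwise bounds and integrability of the tilted kernel\<close>

lemma measurable_a[measurable]: "a \<in> borel_measurable borel"
  using integrable by simp

text \<open>Since \<open>ln 0 = 0\<close>, the limit \<open>- c \<noteq> 0\<close> also shows that \<open>a\<close> is eventually positive.\<close>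

lemma decay_bounds:
  assumes "\<epsilon> > 0"
  shows "\<exists>R\<ge>1. \<forall>x. R \<le> \<bar>x\<bar> \<longrightarrow>
    exp (- (c + \<epsilon>) * \<bar>x\<bar>) \<le> a x \<and> a x \<le> exp (- (c - \<epsilon>) * \<bar>x\<bar>)"
proof -
  have "\<forall>\<^sub>F x in at_infinity. dist (ln (a x) / \<bar>x\<bar>) (- c) < min \<epsilon> c"
    using assms c_pos by (intro tendstoD[OF decay]) auto
  then obtain R where R: "\<And>x. R \<le> \<bar>x\<bar> \<Longrightarrow> dist (ln (a x) / \<bar>x\<bar>) (- c) < min \<epsilon> c"
    unfolding eventually_at_infinity real_norm_def by blast
  have "exp (- (c + \<epsilon>) * \<bar>x\<bar>) \<le> a x \<and> a x \<le> exp (- (c - \<epsilon>) * \<bar>x\<bar>)" if x: "max R 1 \<le> \<bar>x\<bar>" for x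
  proof -
    have x0: "\<bar>x\<bar> > 0" using x by linarith
    have d: "\<bar>ln (a x) / \<bar>x\<bar> + c\<bar> < min \<epsilon> c" using R[of x] x by (simp add: dist_real_def)
    have "a x \<noteq> 0" using d by auto
    then have pos: "a x > 0" using nonneg[of x] by simp
    have "- (c + \<epsilon>) \<le> ln (a x) / \<bar>x\<bar>" "ln (a x) / \<bar>x\<bar> \<le> - (c - \<epsilon>)" using d by linarith+
    then have "- (c + \<epsilon>) * \<bar>x\<bar> \<le> ln (a x)" "ln (a x) \<le> - (c - \<epsilon>) * \<bar>x\<bar>"
      using x0 by (simp_all add: pos_le_divide_eq pos_divide_le_eq)
    then have "exp (- (c + \<epsilon>) * \<bar>x\<bar>) \<le> exp (ln (a x))" "exp (ln (a x)) \<le> exp (- (c - \<epsilon>) * \<bar>x\<bar>)"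
      unfolding exp_le_cancel_iff .
    then show ?thesis using pos by simp
  qed
  then show ?thesis by (intro exI[of _ "max R 1"]) simp
qed

lemma le_bound: "\<exists>M\<ge>0. \<forall>x. a x \<le> M"
proof -
  obtain M where "\<forall>y\<in>range a. norm y \<le> M" using bounded unfolding bounded_iff by blast
  then have M: "norm (a x) \<le> M" for x by blast
  have "a x \<le> M" for x using M[of x] by simp
  moreover have "M \<ge> 0" by (rule order.trans[OF norm_ge_zero M])
  ultimately show ?thesis by blast
qed

text \<open>The decay estimate with \<open>\<epsilon> = c - \<kappa>\<close> has exactly the
  exponent \<open>\<kappa>\<close> outside a bounded interval. Inside, the uniform bound
  \<open>M\<close> is compensated by the factor \<open>exp (\<kappa> * R)\<close>.\<close>

lemma exp_bound:
  assumes "0 \<le> \<kappa>" "\<kappa> < c"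
  shows "\<exists>B>0. \<forall>x. a x \<le> B * exp (- \<kappa> * \<bar>x\<bar>)"
proof -
  obtain M where M0: "M \<ge> 0" and M: "\<And>x. a x \<le> M" using le_bound by blast
  have "0 < c - \<kappa>" using assms by simp
  then obtain R where R: "1 \<le> R" "\<And>x. R \<le> \<bar>x\<bar> \<Longrightarrow> a x \<le> exp (- (c - (c - \<kappa>)) * \<bar>x\<bar>)"
    using decay_bounds[of "c - \<kappa>"] by blast
  show ?thesis
  proof (intro exI[of _ "1 + M * exp (\<kappa> * R)"] conjI allI)
    show "0 < 1 + M * exp (\<kappa> * R)" using M0 by (simp add: add_pos_nonneg)
    show "a x \<le> (1 + M * exp (\<kappa> * R)) * exp (- \<kappa> * \<bar>x\<bar>)" for x
    proof (cases "R \<le> \<bar>x\<bar>")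
      case True
      then have "a x \<le> exp (- \<kappa> * \<bar>x\<bar>)" using R(2)[of x] by simp
      also have "\<dots> \<le> (1 + M * exp (\<kappa> * R)) * exp (- \<kappa> * \<bar>x\<bar>)" using M0 by simp
      finally show ?thesis .
    next
      case False
      then have "\<kappa> * \<bar>x\<bar> \<le> \<kappa> * R" using assms by (intro mult_left_mono) auto
      then have "1 \<le> exp (\<kappa> * R) * exp (- \<kappa> * \<bar>x\<bar>)" by (simp flip: exp_add)
      then have "M * 1 \<le> M * (exp (\<kappa> * R) * exp (- \<kappa> * \<bar>x\<bar>))" using M0 by (rule mult_left_mono)
      also have "\<dots> \<le> (1 + M * exp (\<kappa> * R)) * exp (- \<kappa> * \<bar>x\<bar>)" by (simp add: algebra_simps)
      finally show ?thesis using M[of x] by simp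
    qed
  qed
qed

lemma tilt_bound:
  assumes "0 \<le> \<kappa>" "\<kappa> < c"
  shows "\<exists>B>0. \<forall>x. exp (\<kappa> * x) * a x \<le> B"
proof -
  obtain B where B: "B > 0" "\<And>x. a x \<le> B * exp (- \<kappa> * \<bar>x\<bar>)"
    using exp_bound[OF assms] by blast
  have "exp (\<kappa> * x) * a x \<le> B" for x
  proof -
    have "\<kappa> * x \<le> \<kappa> * \<bar>x\<bar>" using assms by (intro mult_left_mono) auto
    then have "exp (\<kappa> * x) \<le> exp (\<kappa> * \<bar>x\<bar>)" by (simp only: exp_le_cancel_iff)
    then have "exp (\<kappa> * x) * a x \<le> exp (\<kappa> * \<bar>x\<bar>) * (B * exp (- \<kappa> * \<bar>x\<bar>))"
      using B(2) by (rule mult_mono) (simp_all add: nonneg)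
    then show ?thesis by (simp add: exp_minus field_simps)
  qed
  with B(1) show ?thesis by blast
qed

text \<open>Tilt and weight grow at rate at most \<open>\<kappa> + t\<close>. With \<open>s\<close>
  half of the gap to \<open>c\<close>, the kernel decays at rate \<open>\<kappa> + t + s\<close>,
  which leaves the integrable majorant \<open>exp (- s * \<bar>x\<bar>)\<close>.\<close>

lemma integrable_tilt_weight:
  assumes "0 \<le> \<kappa>" "0 \<le> t" "\<kappa> + t < c" and [measurable]: "P \<in> borel_measurable borel"
    and P: "\<And>x. \<bar>P x\<bar> \<le> A * exp (t * \<bar>x\<bar>)"
  shows "integrable lborel (\<lambda>x. P x * (exp (\<kappa> * x) * a x))"
proof -
  define s where "s = (c - (\<kappa> + t)) / 2"
  have s: "s > 0" "0 \<le> \<kappa> + t + s" "\<kappa> + t + s < c" using assms by (auto simp: s_def field_simps)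
  obtain B where B: "B > 0" "\<And>x. a x \<le> B * exp (- (\<kappa> + t + s) * \<bar>x\<bar>)"
    using exp_bound[OF s(2,3)] by blast
  show ?thesis
  proof (rule Bochner_Integration.integrable_bound)
    show "integrable lborel (\<lambda>x. (A * B) * exp (- s * \<bar>x\<bar>))"
      using integrable_exp_minus_abs[OF s(1)] by (rule integrable_mult_right)
    show "AE x in lborel. norm (P x * (exp (\<kappa> * x) * a x)) \<le> norm ((A * B) * exp (- s * \<bar>x\<bar>))"
    proof (rule AE_I2)
      fix x
      have "\<kappa> * x \<le> \<kappa> * \<bar>x\<bar>" using assms by (intro mult_left_mono) auto
      then have "exp (\<kappa> * x) * a x \<le> exp (\<kappa> * \<bar>x\<bar>) * (B * exp (- (\<kappa> + t + s) * \<bar>x\<bar>))"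
        using B nonneg by (intro mult_mono) auto
      then have "\<bar>P x\<bar> * (exp (\<kappa> * x) * a x) \<le> (A * exp (t * \<bar>x\<bar>)) * (exp (\<kappa> * \<bar>x\<bar>) * (B * exp (- (\<kappa> + t + s) * \<bar>x\<bar>)))"
        by (rule mult_mono[OF P]) (use nonneg order.trans[OF abs_ge_zero P] in auto)
      also have "\<dots> = (A * B) * exp (t * \<bar>x\<bar> + (\<kappa> * \<bar>x\<bar> + - (\<kappa> + t + s) * \<bar>x\<bar>))"
        by (simp only: exp_add mult_ac)
      also have "t * \<bar>x\<bar> + (\<kappa> * \<bar>x\<bar> + - (\<kappa> + t + s) * \<bar>x\<bar>) = - s * \<bar>x\<bar>" by (simp add: algebra_simps)
      finally have "\<bar>P x\<bar> * (exp (\<kappa> * x) * a x) \<le> \<bar>(A * B) * exp (- s * \<bar>x\<bar>)\<bar>" by linarith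
      moreover have "norm (P x * (exp (\<kappa> * x) * a x)) = \<bar>P x\<bar> * (exp (\<kappa> * x) * a x)"
        using nonneg[of x] by (simp add: abs_mult)
      ultimately show "norm (P x * (exp (\<kappa> * x) * a x)) \<le> norm ((A * B) * exp (- s * \<bar>x\<bar>))"
        by (simp only: real_norm_def)
    qed
  qed measurable
qed

lemma integrable_tilt:
  assumes "0 \<le> \<kappa>" "\<kappa> < c"
  shows "integrable lborel (\<lambda>x. exp (\<kappa> * x) * a x)"
  using integrable_tilt_weight[of \<kappa> 0 "\<lambda>_. 1" 1] assms by simp

text \<open>The quadratic Taylor bound for the exponential dominates \<open>\<bar>x\<bar>\<close>
  and \<open>x\<^sup>2\<close> by multiples of \<open>exp (t * \<bar>x\<bar>)\<close>, with
  \<open>t\<close> half of the gap between \<open>\<kappa>\<close> and \<open>c\<close>.\<close>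

lemma integrable_tilt_moments:
  assumes "0 \<le> \<kappa>" "\<kappa> < c"
  shows "integrable lborel (\<lambda>x. x * (exp (\<kappa> * x) * a x))"
    and "integrable lborel (\<lambda>x. x\<^sup>2 * (exp (\<kappa> * x) * a x))"
proof -
  define t where "t = (c - \<kappa>) / 2"
  have t: "t > 0" "\<kappa> + t < c" using assms by (auto simp: t_def field_simps)
  have T: "1 + t * \<bar>x\<bar> + (t * \<bar>x\<bar>)\<^sup>2 / 2 \<le> exp (t * \<bar>x\<bar>)" for x
    using t by (intro exp_lower_Taylor_quadratic) simp
  show "integrable lborel (\<lambda>x. x * (exp (\<kappa> * x) * a x))"
  proof (rule integrable_tilt_weight[of \<kappa> t _ "1 / t"])
    fix x
    have "t * \<bar>x\<bar> \<le> exp (t * \<bar>x\<bar>)" using T[of x] zero_le_power2[of "t * \<bar>x\<bar>"] by linarith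
    then show "\<bar>x\<bar> \<le> 1 / t * exp (t * \<bar>x\<bar>)" using t by (simp add: field_simps)
  qed (use assms t in auto)
  show "integrable lborel (\<lambda>x. x\<^sup>2 * (exp (\<kappa> * x) * a x))"
  proof (rule integrable_tilt_weight[of \<kappa> t _ "2 / t\<^sup>2"])
    fix x :: real
    have "0 \<le> t * \<bar>x\<bar>" using t by simp
    then have "(t * \<bar>x\<bar>)\<^sup>2 / 2 \<le> exp (t * \<bar>x\<bar>)" using T[of x] by linarith
    then show "\<bar>x\<^sup>2\<bar> \<le> 2 / t\<^sup>2 * exp (t * \<bar>x\<bar>)" using t by (simp add: field_simps power_mult_distrib)
  qed (use assms t in auto)
qed

section \<open>The transform on the imaginary axis and the mean of the tilted kernel\<close>

definition mgf :: "real \<Rightarrow> real" where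
  "mgf \<kappa> = (\<integral>x. exp (\<kappa> * x) * a x \<partial>lborel)"

lemma fourier_tilt:
  "fourier a (\<i> * complex_of_real \<kappa> + complex_of_real v) = fourier (\<lambda>x. exp (\<kappa> * x) * a x) (complex_of_real v)"
  unfolding fourier_def
proof (intro Bochner_Integration.integral_cong refl)
  fix x
  have "exp (- \<i> * (\<i> * complex_of_real \<kappa> + complex_of_real v) * complex_of_real x)
      = exp (- \<i> * complex_of_real v * complex_of_real x) * complex_of_real (exp (\<kappa> * x))"
    by (simp add: exp_of_real[symmetric] exp_add[symmetric] algebra_simps)
  then show "exp (- \<i> * (\<i> * complex_of_real \<kappa> + complex_of_real v) * complex_of_real x) * complex_of_real (a x)
      = exp (- \<i> * complex_of_real v * complex_of_real x) * complex_of_real (exp (\<kappa> * x) * a x)"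
    by simp
qed

text \<open>This turns the complex equation for \<open>q\<close> into a real one, to which the
  intermediate value theorem applies.\<close>

lemma fourier_imaginary: "fourier a (\<i> * complex_of_real \<kappa>) = complex_of_real (mgf \<kappa>)"
  using fourier_tilt[of \<kappa> 0] fourier_of_real[of "\<lambda>x. exp (\<kappa> * x) * a x" 0]
  by (simp add: mgf_def flip: of_real_mult)

lemma mgf_0: "mgf 0 = 1"
  by (simp add: mgf_def integral)

text \<open>Dominated convergence: for exponents in \<open>{0..\<kappa>}\<close> the tilt is at most
  \<open>exp (\<kappa> * x)\<close> on the right half-line and at most 1 on the left, so the sum of
  the two endpoint integrands is a majorant.\<close>

lemma continuous_on_mgf:
  assumes "0 \<le> \<kappa>" "\<kappa> < c"
  shows "continuous_on {0..\<kappa>} mgf"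
  unfolding continuous_on_sequentially comp_def
proof (intro ballI allI impI, elim conjE)
  fix X :: "nat \<Rightarrow> real" and k assume k: "k \<in> {0..\<kappa>}" and X: "\<forall>n. X n \<in> {0..\<kappa>}" "X \<longlonglongrightarrow> k"
  show "(\<lambda>n. mgf (X n)) \<longlonglongrightarrow> mgf k"
    unfolding mgf_def
  proof (rule integral_dominated_convergence[where w="\<lambda>x. a x + exp (\<kappa> * x) * a x"])
    show "integrable lborel (\<lambda>x. a x + exp (\<kappa> * x) * a x)"
      using integrable integrable_tilt[OF assms] by simp
    show "AE x in lborel. (\<lambda>n. exp (X n * x) * a x) \<longlonglongrightarrow> exp (k * x) * a x"
      by (intro AE_I2 tendsto_intros X)
    show "AE x in lborel. norm (exp (X n * x) * a x) \<le> a x + exp (\<kappa> * x) * a x" for n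
    proof (rule AE_I2)
      fix x
      have "exp (X n * x) \<le> 1 + exp (\<kappa> * x)"
      proof (cases "x \<ge> 0")
        case True
        then have "X n * x \<le> \<kappa> * x" using X(1) by (intro mult_right_mono) auto
        then have "exp (X n * x) \<le> exp (\<kappa> * x)" by (simp only: exp_le_cancel_iff)
        then show ?thesis by linarith
      next
        case False
        then have "X n * x \<le> 0" using X(1) by (intro mult_nonneg_nonpos) auto
        then have "exp (X n * x) \<le> 1" by (simp only: exp_le_one_iff)
        then show ?thesis using exp_ge_zero[of "\<kappa> * x"] by linarith
      qed
      then have "exp (X n * x) * a x \<le> (1 + exp (\<kappa> * x)) * a x" using nonneg by (rule mult_right_mono)
      then show "norm (exp (X n * x) * a x) \<le> a x + exp (\<kappa> * x) * a x"
        using nonneg[of x] by (simp add: algebra_simps abs_mult)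
    qed
  qed auto
qed

text \<open>The function starts at 1, below \<open>1 + l\<close>; reaching that level would, by
  continuity, produce a root, and the root cannot be 0.\<close>

lemma mgf_less:
  assumes "0 < l" "\<nexists>q. 0 < q \<and> q < c \<and> mgf q = 1 + l" "0 \<le> \<kappa>" "\<kappa> < c"
  shows "mgf \<kappa> < 1 + l"
proof (rule ccontr)
  assume "\<not> ?thesis"
  then obtain q where q: "0 \<le> q" "q \<le> \<kappa>" "mgf q = 1 + l"
    using IVT'[OF _ _ _ continuous_on_mgf[OF assms(3,4)], of "1 + l"] assms mgf_0 by auto
  then have "q \<noteq> 0" using mgf_0 assms by auto
  then show False using q assms by force
qed

text \<open>Evenness makes the untilted mean zero. The difference of the two integrands is
  \<open>x * (exp (q * x) - 1) * a x\<close>, which is nonnegative; were its integral zero,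
  \<open>a\<close> would vanish almost everywhere.\<close>

lemma mean_tilt_pos:
  assumes q: "0 < q" "q < c"
  shows "0 < (\<integral>x. x * (exp (q * x) * a x) \<partial>lborel)"
proof -
  have i0: "integrable lborel (\<lambda>x. x * a x)" using integrable_tilt_moments(1)[of 0] c_pos by simp
  have iq: "integrable lborel (\<lambda>x. x * (exp (q * x) * a x))" using integrable_tilt_moments(1)[of q] q by simp
  have "(\<integral>x. x * a x \<partial>lborel) = 0"
    using integral_reflect_shift[of "\<lambda>x. x * a x" 0] even by simp
  then have eq: "(\<integral>x. x * (exp (q * x) * a x) \<partial>lborel) = (\<integral>x. x * (exp (q * x) * a x) - x * a x \<partial>lborel)"
    using i0 iq by simp
  have ge: "0 \<le> x * (exp (q * x) - 1)" for x
    using q by (cases "x \<ge> 0") (auto intro!: mult_nonneg_nonneg mult_nonpos_nonpos simp: mult_nonneg_nonpos)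
  have ge': "0 \<le> x * (exp (q * x) * a x) - x * a x" for x
    using mult_nonneg_nonneg[OF ge[of x] nonneg[of x]] by (simp add: algebra_simps)
  have "(\<integral>x. x * (exp (q * x) * a x) - x * a x \<partial>lborel) \<noteq> 0"
  proof
    assume "(\<integral>x. x * (exp (q * x) * a x) - x * a x \<partial>lborel) = 0"
    then have "AE x in lborel. x * (exp (q * x) * a x) - x * a x = 0"
      using i0 iq ge' by (subst integral_nonneg_eq_0_iff_AE[symmetric]) auto
    with AE_lborel_singleton[of 0] have "AE x in lborel. a x = 0"
    proof eventually_elim
      fix x :: real assume x: "x \<noteq> 0" and "x * (exp (q * x) * a x) - x * a x = 0"
      then have "(exp (q * x) - 1) * a x = 0" by (simp add: algebra_simps)
      then show "a x = 0" using x q by simp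
    qed
    then have "integral\<^sup>L lborel a = 0" by (rule integral_eq_zero_AE)
    then show False using integral by simp
  qed
  moreover have "0 \<le> (\<integral>x. x * (exp (q * x) * a x) - x * a x \<partial>lborel)" using ge' by simp
  ultimately show ?thesis unfolding eq by linarith
qed

section \<open>The resolvent kernel: convergence, exact asymptotics and two-sided bounds\<close>

lemma summable_resolvent:
  assumes "0 < l"
  shows "summable (\<lambda>k. conv_power a (Suc k) x / (1 + l) ^ Suc k)"
proof -
  obtain M where aM: "\<And>x. a x \<le> M" using le_bound by blast
  have le: "conv_power a (Suc k) x \<le> M" for k
    using conv_power_le[OF integrable nonneg aM, of k x] by (simp only: integral power_one mult_1_right)
  show ?thesis
  proof (rule summable_comparison_test')
    show "summable (\<lambda>k. M * (1 / (1 + l)) ^ Suc k)"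
      unfolding power_Suc using assms by (intro summable_mult summable_geometric) simp
    show "norm (conv_power a (Suc k) x / (1 + l) ^ Suc k) \<le> M * (1 / (1 + l)) ^ Suc k" for k
    proof -
      have "norm (conv_power a (Suc k) x / (1 + l) ^ Suc k) = conv_power a (Suc k) x / (1 + l) ^ Suc k"
        unfolding real_norm_def using assms
        by (intro abs_of_nonneg divide_nonneg_nonneg conv_power_nonneg[OF nonneg]) simp
      also have "\<dots> \<le> M / (1 + l) ^ Suc k"
        using le assms by (intro divide_right_mono) simp_all
      also have "\<dots> = M * (1 / (1 + l)) ^ Suc k"
        unfolding power_one_over by simp
      finally show ?thesis .
    qed
  qed
qed

lemma resolvent_even: "resolvent_kernel a l (- x) = resolvent_kernel a l x"
  unfolding resolvent_kernel_def by (simp only: conv_power_even[of a, OF even])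

lemma resolvent_abs: "resolvent_kernel a l \<bar>x\<bar> = resolvent_kernel a l x"
  using resolvent_even[of l x] by (cases "x \<ge> 0") auto

text \<open>The weights \<open>(1 + l) ^ Suc k\<close> and the tilt are absorbed into a single
  function \<open>f\<close>, leaving an unweighted renewal series. Its convergence is inherited from
  the untilted series, so the mass of \<open>f\<close> may be arbitrary here.\<close>

lemma resolvent_tilt:
  fixes l \<kappa> :: real
  defines "f \<equiv> \<lambda>x. 1 / (1 + l) * (exp (\<kappa> * x) * a x)"
  assumes "0 < l"
  shows "(\<lambda>k. conv_power f (Suc k) x) sums (exp (\<kappa> * x) * resolvent_kernel a l x)"
proof -
  have "conv_power f (Suc k) x = exp (\<kappa> * x) * (conv_power a (Suc k) x / (1 + l) ^ Suc k)" for k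
    unfolding f_def conv_power_tilt by (simp add: power_one_over del: conv_power.simps power_Suc)
  then show ?thesis
    unfolding resolvent_kernel_def
    using sums_mult[OF summable_sums[OF summable_resolvent[OF assms(2)]]] by presburger
qed

text \<open>The normalised tilt by \<open>q\<close> is a probability density with positive mean
  \<open>\<mu>\<close>, so the renewal density theorem gives the constant \<open>1 / \<mu>\<close>
  at plus infinity. Evenness transfers it to minus infinity.\<close>

theorem resolvent_asymptotic:
  assumes l: "0 < l" and q: "0 < q" "q < c" "mgf q = 1 + l"
    and L1: "integrable lborel (\<lambda>v::real. fourier a (\<i> * complex_of_real q + complex_of_real v))"
  shows "\<exists>C>0. ((\<lambda>x. exp (q * \<bar>x\<bar>) * resolvent_kernel a l x) \<longlongrightarrow> C) at_infinity"
proof -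
  let ?h = "\<lambda>x. exp (q * x) * a x"
  define f where "f x = 1 / (1 + l) * ?h x" for x
  define \<mu> where "\<mu> = (\<integral>x. x * f x \<partial>lborel)"
  have q0: "0 \<le> q" using q by simp
  obtain B where h_le: "\<And>x. ?h x \<le> B" using tilt_bound[OF q0 q(2)] by blast
  have S: "(\<lambda>k. conv_power f (Suc k) x) sums (exp (q * x) * resolvent_kernel a l x)" for x
    unfolding f_def[abs_def] by (rule resolvent_tilt[OF l])
  have f_alt: "(\<lambda>x. x ^ n * f x) = (\<lambda>x. 1 / (1 + l) * (x ^ n * ?h x))" for n
    by (simp add: f_def fun_eq_iff)
  have m1: "(\<lambda>x. x * f x) = (\<lambda>x. 1 / (1 + l) * (x * ?h x))" using f_alt[of 1] by simp
  have \<mu>: "\<mu> > 0"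
    unfolding \<mu>_def m1 integral_mult_right_zero using mean_tilt_pos[OF q(1,2)] l by simp
  have "fourier f (complex_of_real v) = 1 / (1 + l) * fourier a (\<i> * complex_of_real q + complex_of_real v)" for v
    unfolding fourier_tilt fourier_of_real f_def
    by (subst integral_mult_right_zero[symmetric]) (simp add: mult_ac)
  then have L1': "integrable lborel (\<lambda>v. fourier f (complex_of_real v))"
    using L1 by simp
  have "((\<lambda>x. \<Sum>k. conv_power f (Suc k) x) \<longlongrightarrow> 1 / \<mu>) at_top"
    unfolding \<mu>_def
  proof (rule renewal_density_theorem[where M="1 / (1 + l) * B"])
    show "integrable lborel f" unfolding f_def[abs_def] using integrable_tilt[OF q0 q(2)] by (rule integrable_mult_right)
    show "continuous_on UNIV f" unfolding f_def[abs_def] by (intro continuous_intros cont)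
    show "0 \<le> f x" for x using nonneg l by (simp add: f_def)
    show "f x \<le> 1 / (1 + l) * B" for x unfolding f_def using h_le l by (intro mult_left_mono) auto
    show "integral\<^sup>L lborel f = 1"
      unfolding f_def[abs_def] integral_mult_right_zero using q(3) l by (simp add: mgf_def)
    show "integrable lborel (\<lambda>x. x * f x)" "integrable lborel (\<lambda>x. x\<^sup>2 * f x)"
      unfolding m1 f_alt by (intro integrable_mult_right integrable_tilt_moments[OF q0 q(2)])+
    show "summable (\<lambda>k. conv_power f (Suc k) x)" for x using S by (rule sums_summable)
  qed (use L1' \<mu> in \<open>auto simp: \<mu>_def\<close>)
  then have top': "((\<lambda>x. exp (q * x) * resolvent_kernel a l x) \<longlongrightarrow> 1 / \<mu>) at_top"
    unfolding sums_unique[OF S, symmetric] .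
  have top: "((\<lambda>x. exp (q * \<bar>x\<bar>) * resolvent_kernel a l x) \<longlongrightarrow> 1 / \<mu>) at_top"
    by (rule Lim_transform_eventually[OF top'])
       (use eventually_ge_at_top[of 0] in eventually_elim, simp)
  moreover have "((\<lambda>x. exp (q * \<bar>x\<bar>) * resolvent_kernel a l x) \<longlongrightarrow> 1 / \<mu>) at_bot"
    unfolding filterlim_at_bot_mirror using top by (simp add: resolvent_even)
  ultimately have "((\<lambda>x. exp (q * \<bar>x\<bar>) * resolvent_kernel a l x) \<longlongrightarrow> 1 / \<mu>) at_infinity"
    unfolding at_infinity_eq_at_top_bot by (rule filterlim_sup)
  then show ?thesis using \<mu> by (intro exI[of _ "1 / \<mu>"]) simp
qed

text \<open>The normalised tilt has mass \<open>\<rho> = mgf \<kappa> / (1 + l) < 1\<close>, so its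
  convolution powers are dominated by a convergent geometric series, uniformly in
  \<open>x\<close>.\<close>

lemma resolvent_upper:
  assumes l: "0 < l" and \<kappa>: "0 \<le> \<kappa>" "\<kappa> < c" "mgf \<kappa> < 1 + l"
  shows "\<exists>C>0. \<forall>x. resolvent_kernel a l x \<le> C * exp (- \<kappa> * \<bar>x\<bar>)"
proof -
  let ?h = "\<lambda>x. exp (\<kappa> * x) * a x"
  define f where "f x = 1 / (1 + l) * ?h x" for x
  obtain B where B: "B > 0" and h_le: "\<And>x. ?h x \<le> B" using tilt_bound[OF \<kappa>(1,2)] by blast
  define \<rho> where "\<rho> = integral\<^sup>L lborel f"
  have fi: "integrable lborel f" unfolding f_def[abs_def] using integrable_tilt[OF \<kappa>(1,2)] by (rule integrable_mult_right)
  have f0: "0 \<le> f x" for x using nonneg l by (simp add: f_def)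
  have fB: "f x \<le> B / (1 + l)" for x using h_le[of x] l by (simp add: f_def divide_right_mono)
  have "\<rho> = mgf \<kappa> / (1 + l)" unfolding \<rho>_def f_def[abs_def] integral_mult_right_zero by (simp add: mgf_def)
  then have \<rho>: "\<rho> < 1" using \<kappa> l by simp
  have \<rho>0: "\<rho> \<ge> 0" unfolding \<rho>_def using f0 by simp
  have S: "(\<lambda>k. conv_power f (Suc k) x) sums (exp (\<kappa> * x) * resolvent_kernel a l x)" for x
    unfolding f_def[abs_def] by (rule resolvent_tilt[OF l])
  have "(\<lambda>k. B / (1 + l) * \<rho> ^ k) sums (B / (1 + l) * (1 / (1 - \<rho>)))"
    using \<rho> \<rho>0 by (intro sums_mult geometric_sums) simp
  then have G: "exp (\<kappa> * x) * resolvent_kernel a l x \<le> B / (1 + l) * (1 / (1 - \<rho>))" for x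
    using conv_power_le[OF fi f0 fB, folded \<rho>_def] by (intro sums_le[OF _ S]) auto
  show ?thesis
  proof (intro exI[of _ "B / (1 + l) * (1 / (1 - \<rho>))"] conjI allI)
    show "0 < B / (1 + l) * (1 / (1 - \<rho>))" using B l \<rho> by simp
    show "resolvent_kernel a l x \<le> B / (1 + l) * (1 / (1 - \<rho>)) * exp (- \<kappa> * \<bar>x\<bar>)" for x
    proof -
      \<comment> \<open>The uniform bound is used at \<open>\<bar>x\<bar>\<close>, where the tilt
        has the favourable sign; evenness returns to \<open>x\<close>.\<close>
      have "exp (- \<kappa> * \<bar>x\<bar>) * (exp (\<kappa> * \<bar>x\<bar>) * resolvent_kernel a l \<bar>x\<bar>) \<le> exp (- \<kappa> * \<bar>x\<bar>) * (B / (1 + l) * (1 / (1 - \<rho>)))"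
        using G by (rule mult_left_mono) simp
      moreover have "exp (- \<kappa> * \<bar>x\<bar>) * (exp (\<kappa> * \<bar>x\<bar>) * resolvent_kernel a l \<bar>x\<bar>) = resolvent_kernel a l x"
        unfolding mult.assoc[symmetric] exp_add[symmetric] by (simp add: resolvent_abs)
      ultimately show ?thesis by (simp add: mult.commute)
    qed
  qed
qed

lemma resolvent_ge:
  assumes "0 < l"
  shows "conv_power a (Suc k) x / (1 + l) ^ Suc k \<le> resolvent_kernel a l x"
  using sum_le_suminf[OF summable_resolvent[OF assms, of x], of "{k}"] conv_power_nonneg[OF nonneg] assms
  unfolding resolvent_kernel_def by (simp del: conv_power.simps power_Suc)

text \<open>Where \<open>a\<close> itself may vanish, \<open>a\<^sub>2\<close> is positive: in the convolution integral both \<open>y\<close> and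
  \<open>x - y\<close> can be taken far from the origin.\<close>

lemma resolvent_lower:
  assumes l: "0 < l" and \<epsilon>: "0 < \<epsilon>"
  shows "\<exists>C>0. \<forall>x. C * exp (- (c + \<epsilon>) * \<bar>x\<bar>) \<le> resolvent_kernel a l x"
proof -
  obtain R where R: "1 \<le> R" "\<And>x. R \<le> \<bar>x\<bar> \<Longrightarrow> exp (- (c + \<epsilon>) * \<bar>x\<bar>) \<le> a x"
    using decay_bounds[OF \<epsilon>] by blast
  obtain M where M: "\<And>x. a x \<le> M" using le_bound by blast
  \<comment> \<open>For \<open>\<bar>x\<bar> < R\<close> and \<open>y\<close> in
    \<open>{2 * R..3 * R}\<close>, both \<open>\<bar>y\<bar>\<close> and
    \<open>\<bar>x - y\<bar>\<close> lie between \<open>R\<close> and \<open>4 * R\<close>, so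
    \<open>E\<close> bounds the product of the two kernel values from below. The interval has length
    \<open>R \<ge> 1\<close>.\<close>
  define E where "E = exp (- (c + \<epsilon>) * (4 * R)) * exp (- (c + \<epsilon>) * (4 * R))"
  have E: "E > 0" by (simp add: E_def)
  have a_ge: "exp (- (c + \<epsilon>) * (4 * R)) \<le> a y" if "R \<le> \<bar>y\<bar>" "\<bar>y\<bar> \<le> 4 * R" for y
  proof -
    have "(c + \<epsilon>) * \<bar>y\<bar> \<le> (c + \<epsilon>) * (4 * R)" using that c_pos \<epsilon> by (intro mult_left_mono) auto
    then have "exp (- (c + \<epsilon>) * (4 * R)) \<le> exp (- (c + \<epsilon>) * \<bar>y\<bar>)"
      by (simp only: exp_le_cancel_iff mult_minus_left neg_le_iff_le)
    then show ?thesis using R(2)[OF that(1)] by linarith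
  qed
  have near: "E \<le> conv_power a (Suc (Suc 0)) x" if x: "\<bar>x\<bar> < R" for x
  proof -
    have "E \<le> E * R" using E R by simp
    also have "\<dots> = (\<integral>y. indicator {2 * R..3 * R} y * E \<partial>lborel)" using R by simp
    also have "\<dots> \<le> (\<integral>y. a (x - y) * a y \<partial>lborel)"
    proof (rule integral_mono)
      show "integrable lborel (\<lambda>y. a (x - y) * a y)"
        using M nonneg by (intro integrable_convolution[OF integrable]) auto
      show "integrable lborel (\<lambda>y. indicator {2 * R..3 * R} y * E)"
        by (intro integrable_mult_left integrable_real_indicator) (auto simp: emeasure_lborel_Icc_eq)
      show "indicator {2 * R..3 * R} y * E \<le> a (x - y) * a y" for y
      proof (cases "y \<in> {2 * R..3 * R}")
        case True
        then have "E \<le> a (x - y) * a y"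
          unfolding E_def using x R(1) by (intro mult_mono a_ge nonneg) auto
        then show ?thesis using True by simp
      qed (simp add: nonneg)
    qed
    finally show ?thesis by (simp add: Defs.convolution_def)
  qed
  \<comment> \<open>The first term of the series serves for \<open>\<bar>x\<bar> \<ge> R\<close>,
    the second, at index \<open>Suc 0\<close>, for the bounded remainder.\<close>
  define C where "C = min (1 / (1 + l)) (E / (1 + l) ^ 2)"
  have "C * exp (- (c + \<epsilon>) * \<bar>x\<bar>) \<le> resolvent_kernel a l x" for x
  proof (cases "R \<le> \<bar>x\<bar>")
    case True
    have "C * exp (- (c + \<epsilon>) * \<bar>x\<bar>) \<le> 1 / (1 + l) * a x"
      using R(2)[OF True] l by (intro mult_mono) (auto simp: C_def)
    also have "\<dots> \<le> resolvent_kernel a l x" using resolvent_ge[OF l, of 0 x] by simp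
    finally show ?thesis .
  next
    case False
    have "- (c + \<epsilon>) * \<bar>x\<bar> \<le> 0" using c_pos \<epsilon> by (intro mult_nonpos_nonneg) simp_all
    then have "exp (- (c + \<epsilon>) * \<bar>x\<bar>) \<le> 1" by (simp only: exp_le_one_iff)
    then have "C * exp (- (c + \<epsilon>) * \<bar>x\<bar>) \<le> E / (1 + l) ^ 2 * 1"
      using l E by (intro mult_mono) (simp_all add: C_def)
    also have "\<dots> \<le> conv_power a (Suc (Suc 0)) x / (1 + l) ^ 2"
      using near[of x] False by (simp add: divide_right_mono)
    also have "\<dots> \<le> resolvent_kernel a l x"
      using resolvent_ge[OF l, of "Suc 0" x] by (simp add: numeral_2_eq_2)
    finally show ?thesis .
  qed
  moreover have "C > 0" using l E by (simp add: C_def)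
  ultimately show ?thesis by blast
qed

end

section \<open>Both alternatives in terms of the real equation \<open>mgf q = 1 + l\<close>\<close>

theorem theorem2p3:
  fixes a :: "real \<Rightarrow> real" and c l :: real
  assumes a_nonneg: "\<And>x. 0 \<le> a x"
    and a_bounded: "bounded (range a)"
    and a_cont: "continuous_on UNIV a"
    and a_even: "\<And>x. a (- x) = a x"
    and a_integrable: "integrable lborel a"
    and a_integral: "(\<integral>x. a x \<partial>lborel) = 1"
    and c_pos: "0 < c"
    and a_decay: "((\<lambda>x. ln (a x) / \<bar>x\<bar>) \<longlongrightarrow> - c) at_infinity"
    and fourier_L1: "\<And>\<kappa>. 0 \<le> \<kappa> \<Longrightarrow> \<kappa> < c \<Longrightarrow>
      integrable lborel (\<lambda>v::real. fourier a (\<i> * complex_of_real \<kappa> + complex_of_real v))"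
    and l_pos: "0 < l"
  shows "(\<forall>q. 0 < q \<and> q < c \<and> fourier a (\<i> * complex_of_real q) = complex_of_real (1 + l) \<longrightarrow>
           (\<exists>C>0. \<exists>r. r \<in> o[at_infinity](\<lambda>_. 1) \<and>
             (\<forall>x. resolvent_kernel a l x = exp (- q * \<bar>x\<bar>) * (C + r x)))) \<and>
         ((\<nexists>q. 0 < q \<and> q < c \<and> fourier a (\<i> * complex_of_real q) = complex_of_real (1 + l)) \<longrightarrow>
           (\<forall>\<epsilon>>0. \<exists>C\<^sub>m>0. \<exists>C\<^sub>p>0. \<forall>x.
             C\<^sub>m * exp (- (c + \<epsilon>) * \<bar>x\<bar>) \<le> resolvent_kernel a l x \<and>
             resolvent_kernel a l x \<le> C\<^sub>p * exp (- (c - \<epsilon>) * \<bar>x\<bar>)))"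
proof -
  interpret decaying_kernel a c
    by unfold_locales fact+
  show ?thesis
    unfolding fourier_imaginary of_real_eq_iff
  proof (intro conjI allI impI)
    fix q assume q: "0 < q \<and> q < c \<and> mgf q = 1 + l"
    then have q': "0 < q" "q < c" "mgf q = 1 + l" by simp_all
    obtain C where C: "C > 0" "((\<lambda>x. exp (q * \<bar>x\<bar>) * resolvent_kernel a l x) \<longlongrightarrow> C) at_infinity"
      using resolvent_asymptotic[OF l_pos q' fourier_L1] q' by force
    define r where "r x = exp (q * \<bar>x\<bar>) * resolvent_kernel a l x - C" for x
    have "(r \<longlongrightarrow> 0) at_infinity"
      unfolding r_def[abs_def] using C(2) by (rule LIM_zero)
    then have "r \<in> o[at_infinity](\<lambda>_. 1)" by (intro smalloI_tendsto) auto
    moreover have "resolvent_kernel a l x = exp (- q * \<bar>x\<bar>) * (C + r x)" for x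
    proof -
      have "exp (- q * \<bar>x\<bar>) * exp (q * \<bar>x\<bar>) = 1" by (simp flip: exp_add)
      then have "exp (- q * \<bar>x\<bar>) * (exp (q * \<bar>x\<bar>) * resolvent_kernel a l x) = resolvent_kernel a l x"
        by (simp only: mult.assoc[symmetric] mult_1_left)
      then show ?thesis by (simp add: r_def)
    qed
    ultimately show "\<exists>C>0. \<exists>r. r \<in> o[at_infinity](\<lambda>_. 1) \<and>
        (\<forall>x. resolvent_kernel a l x = exp (- q * \<bar>x\<bar>) * (C + r x))"
      using C(1) by blast
  next
    fix \<epsilon> :: real
    assume no: "\<nexists>q. 0 < q \<and> q < c \<and> mgf q = 1 + l" and \<epsilon>: "0 < \<epsilon>"
    \<comment> \<open>For \<open>\<epsilon> > c\<close> the exponent \<open>c - \<epsilon>\<close>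
      is negative and the required bound grows; truncating at 0 keeps the tilt admissible and proves
      a stronger bound.\<close>
    define \<kappa> where "\<kappa> = max 0 (c - \<epsilon>)"
    have \<kappa>: "0 \<le> \<kappa>" "\<kappa> < c" using c_pos \<epsilon> by (auto simp: \<kappa>_def)
    obtain C where C: "C > 0" "\<And>x. C * exp (- (c + \<epsilon>) * \<bar>x\<bar>) \<le> resolvent_kernel a l x"
      using resolvent_lower[OF l_pos \<epsilon>] by blast
    obtain C' where C': "C' > 0" "\<And>x. resolvent_kernel a l x \<le> C' * exp (- \<kappa> * \<bar>x\<bar>)"
      using resolvent_upper[OF l_pos \<kappa> mgf_less[OF l_pos no \<kappa>]] by blast
    have weaken: "C' * exp (- \<kappa> * \<bar>x\<bar>) \<le> C' * exp (- (c - \<epsilon>) * \<bar>x\<bar>)" for x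
    proof (rule mult_left_mono)
      have "(c - \<epsilon>) * \<bar>x\<bar> \<le> \<kappa> * \<bar>x\<bar>" by (intro mult_right_mono) (auto simp: \<kappa>_def)
      then show "exp (- \<kappa> * \<bar>x\<bar>) \<le> exp (- (c - \<epsilon>) * \<bar>x\<bar>)"
        by (simp only: exp_le_cancel_iff mult_minus_left neg_le_iff_le)
    qed (use C'(1) in simp)
    have "resolvent_kernel a l x \<le> C' * exp (- (c - \<epsilon>) * \<bar>x\<bar>)" for x
      by (rule order.trans[OF C'(2) weaken])
    then show "\<exists>C\<^sub>m>0. \<exists>C\<^sub>p>0. \<forall>x. C\<^sub>m * exp (- (c + \<epsilon>) * \<bar>x\<bar>) \<le> resolvent_kernel a l x \<and>
        resolvent_kernel a l x \<le> C\<^sub>p * exp (- (c - \<epsilon>) * \<bar>x\<bar>)"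
      using C C'(1) by blast
  qed
qed

end
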